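(* Let $(M,\Sigma,\lambda)$ be the completion of a Liouville domain, $J$ an SFT-like almost complex structure with metric $g=d\lambda(\cdot,J\cdot)$, and $H\in C^\infty(M,\mathbb{R})$ a defining Hamiltonian for $(\Sigma,\lambda|_\Sigma)$ with $\Sigma=H^{-1}(0)$ and $H(r,x)=e^r-1$ for all $r>-r_0$ (for some $r_0\in(0,\varepsilon)$), such that $\mathfrak{a}^H$ is Morse-Bott. Let $x^\pm\in\operatorname{crit}(\mathfrak{a}^H)$ and assume that there is a constant $C$ depending only on $x^\pm$ and $H$ with $\max_{s\in\mathbb{R}}|\chi(u(s))|\le C$ for all $u\in\mathcal{M}(x^-,x^+)$. Then there is a compact set $K\subset M$ with $\operatorname{im}(u)\subset K$ for all $u\in\mathcal{M}(x^-,x^+)$.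
   Context: Liouville domain: a compact symplectic manifold $(W,\omega)$ with boundary and a vector field $\Lambda$, transverse to $\partial W$ and outward pointing, such that $\lambda:=\iota_\Lambda\omega$ satisfies $d\lambda=\omega$. Put $\Sigma=\partial W$. Its completion is $M=W\sqcup_\Sigma([0,\infty)\times\Sigma)$; for some $\varepsilon>0$ an open set $U_\varepsilon\supset[0,\infty)\times\Sigma$ has coordinates $(r,x)\in(-\varepsilon,\infty)\times\Sigma$ (from the flow of $\Lambda$, with $\Sigma=\{r=0\}$ and $\{r<0\}\subset W\setminus\Sigma$) in which $\Lambda=\partial_r$, $\lambda=e^r\lambda|_\Sigma$, $\omega=d\lambda=e^r(d\lambda|_\Sigma+dr\wedge\lambda|_\Sigma)$. $R$ is the Reeb vector field of $(\Sigma,\lambda|_\Sigma)$, extended $r$-independently to $U_\varepsilon$; $\xi=\ker\lambda|_\Sigma$. A $d\lambda$-compatible almost complex structure $J$ is SFT-like if on $U_\varepsilon$: $J\Lambda=R$, $J|_\xi$ is $d\lambda|_\xi$-compatible, and $J$ is independent of $r$. $X_H$, $\nabla H$ are defined by $dH=\omega(\cdot,X_H)=g(\nabla H,\cdot)$. $H$ is a defining Hamiltonian if $0$ is a regular value, $\Sigma=H^{-1}(0)$, and $X_H=R$ on $\Sigma$. $\mathbb{S}^1=\mathbb{R}/\mathbb{Z}$. On loops $\gamma:\mathbb{S}^1\to M$ set $\mathfrak{a}(\gamma)=-\int_{\mathbb{S}^1}\gamma^*\lambda$, $h(\gamma)=\int_0^1H(\gamma(t))\,dt$, with $d\mathfrak{a}_\gamma(X)=\int_0^1\omega(\partial_t\gamma,X)\,dt$,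 $dh_\gamma(X)=\int_0^1dH(X)\,dt$. $\mathcal{H}=h^{-1}(0)$; $\mathfrak{a}^H=\mathfrak{a}|_{\mathcal{H}}$; $\chi(\gamma)=-\dfrac{d\mathfrak{a}_\gamma(\nabla H|_\gamma)}{dh_\gamma(\nabla H|_\gamma)}$ for $\gamma\in\mathcal{H}$; the $L^2$-gradient is $\nabla\mathfrak{a}^H(\gamma)=J(\gamma)\partial_t\gamma+\chi(\gamma)\nabla H|_\gamma$. Morse-Bott is meant in the usual sense ($\operatorname{crit}(\mathfrak{a}^H)$ is a properly embedded submanifold whose tangent spaces are the kernels of the Hessian). $\mathcal{M}(x^-,x^+)$ is the set of $u\in C^\infty(\mathbb{R},\mathcal{H})$ (viewed as smooth maps $\mathbb{R}\times\mathbb{S}^1\to M$) with $\partial_su=-\nabla\mathfrak{a}^H(u)$ and $u(s,\cdot)\to x^\pm$ in $C^1$ as $s\to\pm\infty$. *)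

theory Defs
  imports "HOL-Analysis.Analysis"
begin

section \<open>Smooth maps between Euclidean spaces\<close>

text \<open>Both notions are meant for open \<open>S\<close>.\<close>

fun Ck_on :: "nat \<Rightarrow> 'a::real_normed_vector set \<Rightarrow> ('a \<Rightarrow> 'b::real_normed_vector) \<Rightarrow> bool" where
  "Ck_on 0 S f \<longleftrightarrow> continuous_on S f"
| "Ck_on (Suc k) S f \<longleftrightarrow>
     (\<forall>x\<in>S. f differentiable (at x)) \<and> (\<forall>v. Ck_on k S (\<lambda>x. frechet_derivative f (at x) v))"

definition smooth_on :: "'a::real_normed_vector set \<Rightarrow> ('a \<Rightarrow> 'b::real_normed_vector) \<Rightarrow> bool" where
  "smooth_on S f \<longleftrightarrow> (\<forall>k. Ck_on k S f)"


section \<open>Smooth manifolds\<close>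

text \<open>A manifold is a type \<open>'m\<close> (Hausdorff and second countable, by its type classes) with a
  smooth atlas \<open>A\<close> of charts into a Euclidean space \<open>'e\<close>. A chart is given by its domain and
  its coordinate map. Manifolds have no boundary; the Liouville domain below is a
  domain with smooth boundary in its completion.\<close>

type_synonym ('m, 'e) chart = "'m set \<times> ('m \<Rightarrow> 'e)"

abbreviation cdom :: "('m, 'e) chart \<Rightarrow> 'm set" where "cdom c \<equiv> fst c"
abbreviation cmap :: "('m, 'e) chart \<Rightarrow> 'm \<Rightarrow> 'e" where "cmap c \<equiv> snd c"
abbreviation cinv :: "('m, 'e) chart \<Rightarrow> 'e \<Rightarrow> 'm" where "cinv c \<equiv> inv_into (fst c) (snd c)"

definition smooth_atlas ::
    "('m::{t2_space,second_countable_topology}, 'e::euclidean_space) chart set \<Rightarrow> bool" where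
  "smooth_atlas A \<longleftrightarrow>
     (\<Union>c\<in>A. cdom c) = UNIV \<and>
     (\<forall>c\<in>A. open (cdom c) \<and> open (cmap c ` cdom c) \<and>
            homeomorphism (cdom c) (cmap c ` cdom c) (cmap c) (cinv c)) \<and>
     (\<forall>c\<in>A. \<forall>d\<in>A. smooth_on (cmap c ` (cdom c \<inter> cdom d)) (cmap d \<circ> cinv c))"

text \<open>The tangent space at \<open>p\<close> is the model space \<open>'e\<close>, a vector being represented by its
  coordinates in the preferred chart \<open>chart_at A p\<close>. Hence vector fields are functions
  \<open>'m \<Rightarrow> 'e\<close>, one-forms are functions \<open>'m \<Rightarrow> 'e \<Rightarrow> real\<close>, and so on. The preferred chart
  need not vary continuously with \<open>p\<close>: smoothness of a tensor field is always tested after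
  passing to the coordinates of a fixed chart \<open>c\<close>, by means of \<open>to_coord\<close> and \<open>from_coord\<close>.\<close>

definition chart_at :: "('m, 'e) chart set \<Rightarrow> 'm \<Rightarrow> ('m, 'e) chart" where
  "chart_at A p = (SOME c. c \<in> A \<and> p \<in> cdom c)"

definition to_coord ::
    "('m, 'e::euclidean_space) chart set \<Rightarrow> ('m, 'e) chart \<Rightarrow> 'm \<Rightarrow> 'e \<Rightarrow> 'e" where
  "to_coord A c p v =
     frechet_derivative (cmap c \<circ> cinv (chart_at A p)) (at (cmap (chart_at A p) p)) v"

definition from_coord ::
    "('m, 'e::euclidean_space) chart set \<Rightarrow> ('m, 'e) chart \<Rightarrow> 'm \<Rightarrow> 'e \<Rightarrow> 'e" where
  "from_coord A c p v =
     frechet_derivative (cmap (chart_at A p) \<circ> cinv c) (at (cmap c p)) v"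

definition smooth_fun ::
    "('m, 'e::euclidean_space) chart set \<Rightarrow> 'm set \<Rightarrow> ('m \<Rightarrow> real) \<Rightarrow> bool" where
  "smooth_fun A U f \<longleftrightarrow> (\<forall>c\<in>A. smooth_on (cmap c ` (cdom c \<inter> U)) (f \<circ> cinv c))"

definition diff_fun ::
    "('m, 'e::euclidean_space) chart set \<Rightarrow> ('m \<Rightarrow> real) \<Rightarrow> 'm \<Rightarrow> 'e \<Rightarrow> real" where
  "diff_fun A f p v = frechet_derivative (f \<circ> cinv (chart_at A p)) (at (cmap (chart_at A p) p)) v"

text \<open>Smooth maps from an open subset of a normed space into the manifold.\<close>

definition smooth_into :: "('m::topological_space, 'e::euclidean_space) chart set \<Rightarrow>
    'a::real_normed_vector set \<Rightarrow> ('a \<Rightarrow> 'm) \<Rightarrow> bool" where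
  "smooth_into A S f \<longleftrightarrow>
     continuous_on S f \<and> (\<forall>c\<in>A. smooth_on {x\<in>S. f x \<in> cdom c} (cmap c \<circ> f))"

definition smooth_map ::
    "('m::topological_space, 'e::euclidean_space) chart set \<Rightarrow> 'm set \<Rightarrow> ('m \<Rightarrow> 'm) \<Rightarrow> bool" where
  "smooth_map A U f \<longleftrightarrow> (\<forall>c\<in>A. smooth_into A (cmap c ` (cdom c \<inter> U)) (f \<circ> cinv c))"

definition diff_map ::
    "('m, 'e::euclidean_space) chart set \<Rightarrow> ('m \<Rightarrow> 'm) \<Rightarrow> 'm \<Rightarrow> 'e \<Rightarrow> 'e" where
  "diff_map A f p v =
     frechet_derivative (cmap (chart_at A (f p)) \<circ> f \<circ> cinv (chart_at A p))
       (at (cmap (chart_at A p) p)) v"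

definition velocity :: "('m, 'e::euclidean_space) chart set \<Rightarrow> (real \<Rightarrow> 'm) \<Rightarrow> real \<Rightarrow> 'e" where
  "velocity A \<gamma> t = vector_derivative (\<lambda>\<tau>. cmap (chart_at A (\<gamma> t)) (\<gamma> \<tau>)) (at t)"

text \<open>Tangent space of a submanifold \<open>S\<close> at \<open>p\<close>.\<close>

definition tangent_space ::
    "('m::topological_space, 'e::euclidean_space) chart set \<Rightarrow> 'm set \<Rightarrow> 'm \<Rightarrow> 'e set" where
  "tangent_space A S p =
     {velocity A \<gamma> 0 | \<gamma>. \<exists>\<delta>>0. smooth_into A {-\<delta><..<\<delta>} \<gamma> \<and> \<gamma> 0 = p \<and> \<gamma> ` {-\<delta><..<\<delta>} \<subseteq> S}"

definition smooth_vector_field ::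
    "('m, 'e::euclidean_space) chart set \<Rightarrow> ('m \<Rightarrow> 'e) \<Rightarrow> bool" where
  "smooth_vector_field A X \<longleftrightarrow>
     (\<forall>c\<in>A. smooth_on (cmap c ` cdom c) (\<lambda>x. to_coord A c (cinv c x) (X (cinv c x))))"

definition form1_in :: "('m, 'e::euclidean_space) chart set \<Rightarrow> ('m, 'e) chart \<Rightarrow>
    ('m \<Rightarrow> 'e \<Rightarrow> real) \<Rightarrow> 'e \<Rightarrow> 'e \<Rightarrow> real" where
  "form1_in A c \<alpha> x v = \<alpha> (cinv c x) (from_coord A c (cinv c x) v)"

definition form2_in :: "('m, 'e::euclidean_space) chart set \<Rightarrow> ('m, 'e) chart \<Rightarrow>
    ('m \<Rightarrow> 'e \<Rightarrow> 'e \<Rightarrow> real) \<Rightarrow> 'e \<Rightarrow> 'e \<Rightarrow> 'e \<Rightarrow> real" where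
  "form2_in A c \<omega> x v w =
     \<omega> (cinv c x) (from_coord A c (cinv c x) v) (from_coord A c (cinv c x) w)"

text \<open>Exterior derivatives at \<open>p\<close>, computed in the preferred chart at \<open>p\<close>
  (where \<open>from_coord A (chart_at A p) p\<close> is the identity).\<close>

definition ext_deriv1 :: "('m, 'e::euclidean_space) chart set \<Rightarrow>
    ('m \<Rightarrow> 'e \<Rightarrow> real) \<Rightarrow> 'm \<Rightarrow> 'e \<Rightarrow> 'e \<Rightarrow> real" where
  "ext_deriv1 A \<alpha> p v w =
     (let c = chart_at A p; D = (\<lambda>f. frechet_derivative f (at (cmap c p))) in
      D (\<lambda>x. form1_in A c \<alpha> x w) v - D (\<lambda>x. form1_in A c \<alpha> x v) w)"

definition ext_deriv2 :: "('m, 'e::euclidean_space) chart set \<Rightarrow>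
    ('m \<Rightarrow> 'e \<Rightarrow> 'e \<Rightarrow> real) \<Rightarrow> 'm \<Rightarrow> 'e \<Rightarrow> 'e \<Rightarrow> 'e \<Rightarrow> real" where
  "ext_deriv2 A \<omega> p u v w =
     (let c = chart_at A p; D = (\<lambda>f. frechet_derivative f (at (cmap c p))) in
      D (\<lambda>x. form2_in A c \<omega> x v w) u + D (\<lambda>x. form2_in A c \<omega> x w u) v
      + D (\<lambda>x. form2_in A c \<omega> x u v) w)"

definition symplectic_form ::
    "('m, 'e::euclidean_space) chart set \<Rightarrow> ('m \<Rightarrow> 'e \<Rightarrow> 'e \<Rightarrow> real) \<Rightarrow> bool" where
  "symplectic_form A \<omega> \<longleftrightarrow>
     (\<forall>p. bilinear (\<omega> p)) \<and>
     (\<forall>p v. \<omega> p v v = 0) \<and>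
     (\<forall>p v. (\<forall>w. \<omega> p v w = 0) \<longrightarrow> v = 0) \<and>
     (\<forall>c\<in>A. \<forall>v w. smooth_on (cmap c ` cdom c) (\<lambda>x. form2_in A c \<omega> x v w)) \<and>
     (\<forall>p u v w. ext_deriv2 A \<omega> p u v w = 0)"


section \<open>Liouville domains and their completions\<close>

definition liouville_form ::
    "('m \<Rightarrow> 'e \<Rightarrow> 'e \<Rightarrow> real) \<Rightarrow> ('m \<Rightarrow> 'e) \<Rightarrow> 'm \<Rightarrow> 'e \<Rightarrow> real" where
  "liouville_form \<omega> \<Lambda> p v = \<omega> p (\<Lambda> p) v"

definition exact_symplectic :: "('m, 'e::euclidean_space) chart set \<Rightarrow>
    ('m \<Rightarrow> 'e \<Rightarrow> 'e \<Rightarrow> real) \<Rightarrow> ('m \<Rightarrow> 'e) \<Rightarrow> bool" where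
  "exact_symplectic A \<omega> \<Lambda> \<longleftrightarrow>
     symplectic_form A \<omega> \<and> smooth_vector_field A \<Lambda> \<and>
     (\<forall>p v w. ext_deriv1 A (liouville_form \<omega> \<Lambda>) p v w = \<omega> p v w)"

text \<open>\<open>f\<close> is a local defining function of the domain \<open>W\<close> near \<open>p\<close>.\<close>

definition local_defining :: "('m::topological_space, 'e::euclidean_space) chart set \<Rightarrow>
    'm set \<Rightarrow> 'm \<Rightarrow> 'm set \<Rightarrow> ('m \<Rightarrow> real) \<Rightarrow> bool" where
  "local_defining A W p N f \<longleftrightarrow>
     open N \<and> p \<in> N \<and> smooth_fun A N f \<and> f p = 0 \<and> (\<exists>v. diff_fun A f p v \<noteq> 0) \<and>
     W \<inter> N = {q\<in>N. f q \<le> 0}"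

text \<open>A Liouville domain \<open>(W, \<omega>|\<^sub>W)\<close> with Liouville vector field \<open>\<Lambda>|\<^sub>W\<close>, where \<open>W\<close> is a
  domain with smooth boundary in an ambient manifold of the same dimension. Its boundary
  (as a manifold with boundary) is the topological boundary \<open>frontier W\<close>.\<close>

definition liouville_domain :: "('m::topological_space, 'e::euclidean_space) chart set \<Rightarrow>
    'm set \<Rightarrow> ('m \<Rightarrow> 'e \<Rightarrow> 'e \<Rightarrow> real) \<Rightarrow> ('m \<Rightarrow> 'e) \<Rightarrow> bool" where
  "liouville_domain A W \<omega> \<Lambda> \<longleftrightarrow>
     exact_symplectic A \<omega> \<Lambda> \<and> compact W \<and>
     (\<forall>p\<in>frontier W. \<exists>N f. local_defining A W p N f \<and> diff_fun A f p (\<Lambda> p) > 0)"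

text \<open>The manifold is the completion of the Liouville domain \<open>W\<close>, with coordinates
  \<open>(r, x) \<in> (-\<epsilon>, \<infinity>) \<times> \<Sigma>\<close> on the open set \<open>U\<close>, where \<open>\<Sigma> = frontier W\<close> and \<open>x = \<pi> p\<close>.
  A smooth homeomorphism onto \<open>(-\<epsilon>, \<infinity>) \<times> \<Sigma>\<close> all of whose differentials are injective is a
  diffeomorphism, the dimensions being equal. The last clause but one says
  \<open>\<Lambda> = \<partial>\<^sub>r\<close>, and the last one that \<open>\<lambda>\<close> equals \<open>e\<^sup>r \<lambda>|\<^sub>\<Sigma>\<close> (so that
  \<open>\<omega> = e\<^sup>r (d\<lambda>|\<^sub>\<Sigma> + dr \<and> \<lambda>|\<^sub>\<Sigma>)\<close>, as \<open>\<omega> = d\<lambda>\<close>).\<close>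

definition completion_coords :: "('m::topological_space, 'e::euclidean_space) chart set \<Rightarrow>
    'm set \<Rightarrow> ('m \<Rightarrow> 'e \<Rightarrow> 'e \<Rightarrow> real) \<Rightarrow> ('m \<Rightarrow> 'e) \<Rightarrow>
    real \<Rightarrow> 'm set \<Rightarrow> ('m \<Rightarrow> real) \<Rightarrow> ('m \<Rightarrow> 'm) \<Rightarrow> bool" where
  "completion_coords A W \<omega> \<Lambda> \<epsilon> U r \<pi> \<longleftrightarrow>
     \<epsilon> > 0 \<and> open U \<and>
     smooth_fun A U r \<and> smooth_map A U \<pi> \<and>
     (\<exists>g. homeomorphism U ({-\<epsilon><..} \<times> frontier W) (\<lambda>p. (r p, \<pi> p)) g) \<and>
     (\<forall>p\<in>U. \<forall>v. diff_fun A r p v = 0 \<and> diff_map A \<pi> p v = 0 \<longrightarrow> v = 0) \<and>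
     {p\<in>U. r p = 0} = frontier W \<and> (\<forall>p\<in>frontier W. \<pi> p = p) \<and>
     {p\<in>U. r p < 0} \<subseteq> W - frontier W \<and>
     {p\<in>U. r p > 0} = - W \<and>
     (\<forall>p\<in>U. diff_fun A r p (\<Lambda> p) = 1 \<and> diff_map A \<pi> p (\<Lambda> p) = 0) \<and>
     (\<forall>p\<in>U. \<forall>v. liouville_form \<omega> \<Lambda> p v
        = exp (r p) * liouville_form \<omega> \<Lambda> (\<pi> p) (diff_map A \<pi> p v))"

definition reeb_field :: "('m::topological_space, 'e::euclidean_space) chart set \<Rightarrow>
    'm set \<Rightarrow> ('m \<Rightarrow> 'e \<Rightarrow> 'e \<Rightarrow> real) \<Rightarrow> ('m \<Rightarrow> 'e) \<Rightarrow> ('m \<Rightarrow> 'e) \<Rightarrow> bool" where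
  "reeb_field A W \<omega> \<Lambda> R \<longleftrightarrow>
     (\<forall>x\<in>frontier W. R x \<in> tangent_space A (frontier W) x \<and> liouville_form \<omega> \<Lambda> x (R x) = 1 \<and>
        (\<forall>v\<in>tangent_space A (frontier W) x.
           ext_deriv1 A (liouville_form \<omega> \<Lambda>) x (R x) v = 0))"

text \<open>\<open>R\<close> on \<open>U\<close> is the \<open>r\<close>-independent extension of \<open>R\<close> on \<open>\<Sigma>\<close>.\<close>

definition r_invariant_field :: "('m, 'e::euclidean_space) chart set \<Rightarrow>
    'm set \<Rightarrow> ('m \<Rightarrow> real) \<Rightarrow> ('m \<Rightarrow> 'm) \<Rightarrow> ('m \<Rightarrow> 'e) \<Rightarrow> bool" where
  "r_invariant_field A U r \<pi> R \<longleftrightarrow>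
     (\<forall>p\<in>U. diff_fun A r p (R p) = 0 \<and> diff_map A \<pi> p (R p) = R (\<pi> p))"

text \<open>The contact structure \<open>\<xi> = ker \<lambda>|\<^sub>\<Sigma>\<close>, extended \<open>r\<close>-independently to \<open>U\<close>.\<close>

definition contact_plane :: "('m, 'e::euclidean_space) chart set \<Rightarrow>
    ('m \<Rightarrow> 'e \<Rightarrow> 'e \<Rightarrow> real) \<Rightarrow> ('m \<Rightarrow> 'e) \<Rightarrow> ('m \<Rightarrow> real) \<Rightarrow> ('m \<Rightarrow> 'm) \<Rightarrow> 'm \<Rightarrow> 'e set" where
  "contact_plane A \<omega> \<Lambda> r \<pi> p =
     {v. diff_fun A r p v = 0 \<and> liouville_form \<omega> \<Lambda> (\<pi> p) (diff_map A \<pi> p v) = 0}"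

definition almost_complex :: "('m, 'e::euclidean_space) chart set \<Rightarrow> ('m \<Rightarrow> 'e \<Rightarrow> 'e) \<Rightarrow> bool" where
  "almost_complex A J \<longleftrightarrow>
     (\<forall>p. linear (J p)) \<and> (\<forall>p v. J p (J p v) = - v) \<and>
     (\<forall>c\<in>A. \<forall>v. smooth_on (cmap c ` cdom c)
        (\<lambda>x. to_coord A c (cinv c x) (J (cinv c x) (from_coord A c (cinv c x) v))))"

definition metric :: "('m \<Rightarrow> 'e \<Rightarrow> 'e \<Rightarrow> real) \<Rightarrow> ('m \<Rightarrow> 'e \<Rightarrow> 'e) \<Rightarrow> 'm \<Rightarrow> 'e \<Rightarrow> 'e \<Rightarrow> real" where
  "metric \<omega> J p v w = \<omega> p v (J p w)"

text \<open>\<open>J\<close> preserves the subspace \<open>V\<close> of the tangent space at \<open>p\<close> and is compatible with the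
  restriction of \<open>\<omega>\<close> to \<open>V\<close>.\<close>

definition compatible_at :: "('m \<Rightarrow> 'e::real_vector \<Rightarrow> 'e \<Rightarrow> real) \<Rightarrow> ('m \<Rightarrow> 'e \<Rightarrow> 'e) \<Rightarrow>
    'm \<Rightarrow> 'e set \<Rightarrow> bool" where
  "compatible_at \<omega> J p V \<longleftrightarrow>
     (\<forall>v\<in>V. J p v \<in> V) \<and>
     (\<forall>v\<in>V. \<forall>w\<in>V. \<omega> p (J p v) (J p w) = \<omega> p v w) \<and>
     (\<forall>v\<in>V. v \<noteq> 0 \<longrightarrow> metric \<omega> J p v v > 0)"

text \<open>The last clause is \<open>r\<close>-independence: in the splitting
  \<open>T\<^sub>p M = \<real> \<partial>\<^sub>r \<oplus> T\<^sub>x \<Sigma>\<close> the endomorphism \<open>J p\<close> depends only on \<open>x = \<pi> p\<close>.\<close>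

definition sft_like :: "('m, 'e::euclidean_space) chart set \<Rightarrow>
    ('m \<Rightarrow> 'e \<Rightarrow> 'e \<Rightarrow> real) \<Rightarrow> ('m \<Rightarrow> 'e) \<Rightarrow>
    'm set \<Rightarrow> ('m \<Rightarrow> real) \<Rightarrow> ('m \<Rightarrow> 'm) \<Rightarrow> ('m \<Rightarrow> 'e) \<Rightarrow> ('m \<Rightarrow> 'e \<Rightarrow> 'e) \<Rightarrow> bool" where
  "sft_like A \<omega> \<Lambda> U r \<pi> R J \<longleftrightarrow>
     almost_complex A J \<and> (\<forall>p. compatible_at \<omega> J p UNIV) \<and>
     (\<forall>p\<in>U. J p (\<Lambda> p) = R p) \<and>
     (\<forall>p\<in>U. compatible_at \<omega> J p (contact_plane A \<omega> \<Lambda> r \<pi> p)) \<and>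
     (\<forall>p\<in>U. \<forall>q\<in>U. \<pi> p = \<pi> q \<longrightarrow>
        (\<forall>v w. diff_fun A r p v = diff_fun A r q w \<and> diff_map A \<pi> p v = diff_map A \<pi> q w \<longrightarrow>
           diff_fun A r p (J p v) = diff_fun A r q (J q w) \<and>
           diff_map A \<pi> p (J p v) = diff_map A \<pi> q (J q w)))"

definition ham_field :: "('m, 'e::euclidean_space) chart set \<Rightarrow>
    ('m \<Rightarrow> 'e \<Rightarrow> 'e \<Rightarrow> real) \<Rightarrow> ('m \<Rightarrow> real) \<Rightarrow> 'm \<Rightarrow> 'e" where
  "ham_field A \<omega> H p = (THE X. \<forall>v. diff_fun A H p v = \<omega> p v X)"

definition grad_field :: "('m, 'e::euclidean_space) chart set \<Rightarrow>
    ('m \<Rightarrow> 'e \<Rightarrow> 'e \<Rightarrow> real) \<Rightarrow> ('m \<Rightarrow> 'e \<Rightarrow> 'e) \<Rightarrow> ('m \<Rightarrow> real) \<Rightarrow> 'm \<Rightarrow> 'e" where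
  "grad_field A \<omega> J H p = (THE Y. \<forall>v. diff_fun A H p v = metric \<omega> J p Y v)"

definition defining_hamiltonian :: "('m::topological_space, 'e::euclidean_space) chart set \<Rightarrow>
    'm set \<Rightarrow> ('m \<Rightarrow> 'e \<Rightarrow> 'e \<Rightarrow> real) \<Rightarrow> ('m \<Rightarrow> 'e) \<Rightarrow> ('m \<Rightarrow> real) \<Rightarrow> bool" where
  "defining_hamiltonian A W \<omega> R H \<longleftrightarrow>
     smooth_fun A UNIV H \<and>
     (\<forall>p. H p = 0 \<longrightarrow> (\<exists>v. diff_fun A H p v \<noteq> 0)) \<and>
     frontier W = H -` {0} \<and>
     (\<forall>p\<in>frontier W. ham_field A \<omega> H p = R p)"


section \<open>Loops, the constrained action functional and its gradient lines\<close>

text \<open>Loops on \<open>\<real>/\<int>\<close> are 1-periodic functions on the real line. A vector field along a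
  loop \<open>\<gamma>\<close> is a 1-periodic function \<open>X\<close> with \<open>X t\<close> in the tangent space at \<open>\<gamma> t\<close>.\<close>

definition loops :: "('m::topological_space, 'e::euclidean_space) chart set \<Rightarrow> (real \<Rightarrow> 'm) set" where
  "loops A = {\<gamma>. smooth_into A UNIV \<gamma> \<and> (\<forall>t. \<gamma> (t + 1) = \<gamma> t)}"

definition fields_along :: "('m::topological_space, 'e::euclidean_space) chart set \<Rightarrow>
    (real \<Rightarrow> 'm) \<Rightarrow> (real \<Rightarrow> 'e) set" where
  "fields_along A \<gamma> = {X. (\<forall>t. X (t + 1) = X t) \<and>
     (\<forall>c\<in>A. smooth_on {t. \<gamma> t \<in> cdom c} (\<lambda>t. to_coord A c (\<gamma> t) (X t)))}"

definition action :: "('m, 'e::euclidean_space) chart set \<Rightarrow>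
    ('m \<Rightarrow> 'e \<Rightarrow> 'e \<Rightarrow> real) \<Rightarrow> ('m \<Rightarrow> 'e) \<Rightarrow> (real \<Rightarrow> 'm) \<Rightarrow> real" where
  "action A \<omega> \<Lambda> \<gamma> = - integral {0..1} (\<lambda>t. liouville_form \<omega> \<Lambda> (\<gamma> t) (velocity A \<gamma> t))"

definition mean :: "('m \<Rightarrow> real) \<Rightarrow> (real \<Rightarrow> 'm) \<Rightarrow> real" where
  "mean H \<gamma> = integral {0..1} (\<lambda>t. H (\<gamma> t))"

definition diff_action :: "('m, 'e::euclidean_space) chart set \<Rightarrow>
    ('m \<Rightarrow> 'e \<Rightarrow> 'e \<Rightarrow> real) \<Rightarrow> (real \<Rightarrow> 'm) \<Rightarrow> (real \<Rightarrow> 'e) \<Rightarrow> real" where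
  "diff_action A \<omega> \<gamma> X = integral {0..1} (\<lambda>t. \<omega> (\<gamma> t) (velocity A \<gamma> t) (X t))"

definition diff_mean :: "('m, 'e::euclidean_space) chart set \<Rightarrow>
    ('m \<Rightarrow> real) \<Rightarrow> (real \<Rightarrow> 'm) \<Rightarrow> (real \<Rightarrow> 'e) \<Rightarrow> real" where
  "diff_mean A H \<gamma> X = integral {0..1} (\<lambda>t. diff_fun A H (\<gamma> t) (X t))"

definition zero_mean_loops :: "('m::topological_space, 'e::euclidean_space) chart set \<Rightarrow>
    ('m \<Rightarrow> real) \<Rightarrow> (real \<Rightarrow> 'm) set" where
  "zero_mean_loops A H = {\<gamma> \<in> loops A. mean H \<gamma> = 0}"

definition zero_mean_tangent :: "('m::topological_space, 'e::euclidean_space) chart set \<Rightarrow>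
    ('m \<Rightarrow> real) \<Rightarrow> (real \<Rightarrow> 'm) \<Rightarrow> (real \<Rightarrow> 'e) set" where
  "zero_mean_tangent A H \<gamma> = {X \<in> fields_along A \<gamma>. diff_mean A H \<gamma> X = 0}"

definition crit :: "('m::topological_space, 'e::euclidean_space) chart set \<Rightarrow>
    ('m \<Rightarrow> 'e \<Rightarrow> 'e \<Rightarrow> real) \<Rightarrow> ('m \<Rightarrow> real) \<Rightarrow> (real \<Rightarrow> 'm) set" where
  "crit A \<omega> H =
     {\<gamma> \<in> zero_mean_loops A H. \<forall>X\<in>zero_mean_tangent A H \<gamma>. diff_action A \<omega> \<gamma> X = 0}"

definition chi :: "('m, 'e::euclidean_space) chart set \<Rightarrow>
    ('m \<Rightarrow> 'e \<Rightarrow> 'e \<Rightarrow> real) \<Rightarrow> ('m \<Rightarrow> 'e \<Rightarrow> 'e) \<Rightarrow> ('m \<Rightarrow> real) \<Rightarrow> (real \<Rightarrow> 'm) \<Rightarrow> real" where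
  "chi A \<omega> J H \<gamma> =
     - (diff_action A \<omega> \<gamma> (\<lambda>t. grad_field A \<omega> J H (\<gamma> t))
        / diff_mean A H \<gamma> (\<lambda>t. grad_field A \<omega> J H (\<gamma> t)))"

definition grad_action :: "('m, 'e::euclidean_space) chart set \<Rightarrow>
    ('m \<Rightarrow> 'e \<Rightarrow> 'e \<Rightarrow> real) \<Rightarrow> ('m \<Rightarrow> 'e \<Rightarrow> 'e) \<Rightarrow> ('m \<Rightarrow> real) \<Rightarrow> (real \<Rightarrow> 'm) \<Rightarrow> real \<Rightarrow> 'e" where
  "grad_action A \<omega> J H \<gamma> t =
     J (\<gamma> t) (velocity A \<gamma> t) + chi A \<omega> J H \<gamma> *\<^sub>R grad_field A \<omega> J H (\<gamma> t)"

text \<open>The \<open>C\<^sup>k\<close>-topology on loops (\<open>k = \<infinity>\<close> allowed), as the topology of uniform convergence of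
  the derivatives of order at most \<open>k\<close> of \<open>f \<circ> \<gamma>\<close>, for all smooth functions \<open>f\<close> on the manifold.
  As the manifold embeds into some Euclidean space and loops have compact domain, this
  is the usual topology.\<close>

definition loop_topology :: "('m::topological_space, 'e::euclidean_space) chart set \<Rightarrow> enat \<Rightarrow>
    (real \<Rightarrow> 'm) topology" where
  "loop_topology A k = topology_generated_by
     {{\<gamma> \<in> loops A. \<forall>t. \<bar>(deriv ^^ j) (f \<circ> \<gamma>) t - (deriv ^^ j) (f \<circ> \<gamma>\<^sub>0) t\<bar> < \<delta>} | f j \<gamma>\<^sub>0 \<delta>.
        smooth_fun A UNIV f \<and> enat j \<le> k \<and> \<gamma>\<^sub>0 \<in> loops A \<and> \<delta> > 0}"

text \<open>A properly embedded finite-dimensional submanifold of the space \<open>\<H>\<close> of loops: a closed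
  subset, locally the homeomorphic image of an open subset of a vector space \<open>L\<close> under a smooth
  immersion \<open>\<phi>\<close>. The dimension of \<open>L\<close> may depend on the component. Taking \<open>L\<close> inside the model
  space \<open>'e\<close> of the manifold (and \<open>\<phi>\<close> defined on an open set of \<open>'e\<close>, only its restriction to \<open>L\<close>
  being used) loses nothing for critical manifolds: a kernel element of the Hessian at a
  critical loop \<open>\<gamma>\<close> solves a linear first-order equation and so is determined by an initial value
  in \<open>T\<^bsub>\<gamma>(0)\<^esub>\<Sigma>\<close> and the variation of the Lagrange multiplier, whence the dimension is at most
  \<open>DIM('e)\<close>.\<close>

definition properly_embedded :: "('m::topological_space, 'e::euclidean_space) chart set \<Rightarrow>
    (real \<Rightarrow> 'm) set \<Rightarrow> (real \<Rightarrow> 'm) set \<Rightarrow> bool" where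
  "properly_embedded A \<H> C \<longleftrightarrow>
     C \<subseteq> \<H> \<and>
     closedin (subtopology (loop_topology A \<infinity>) \<H>) C \<and>
     (\<forall>\<gamma>\<in>C. \<exists>(L :: 'e set) V N \<phi>.
        subspace L \<and> open V \<and> openin (loop_topology A \<infinity>) N \<and> \<gamma> \<in> N \<and>
        smooth_into A (V \<times> UNIV) (\<lambda>(v, t). \<phi> v t) \<and>
        homeomorphic_map (top_of_set (V \<inter> L)) (subtopology (loop_topology A \<infinity>) (C \<inter> N)) \<phi> \<and>
        (\<forall>v\<in>V \<inter> L. \<forall>w\<in>L. (\<forall>t. velocity A (\<lambda>s. \<phi> (v + s *\<^sub>R w) t) 0 = 0) \<longrightarrow> w = 0))"

definition loop_tangent_space :: "('m::topological_space, 'e::euclidean_space) chart set \<Rightarrow>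
    (real \<Rightarrow> 'm) set \<Rightarrow> (real \<Rightarrow> 'm) \<Rightarrow> (real \<Rightarrow> 'e) set" where
  "loop_tangent_space A C \<gamma> =
     {(\<lambda>t. velocity A (\<lambda>s. \<Gamma> s t) 0) | \<Gamma>. \<exists>\<delta>>0.
        smooth_into A ({-\<delta><..<\<delta>} \<times> UNIV) (\<lambda>(s, t). \<Gamma> s t) \<and>
        \<Gamma> 0 = \<gamma> \<and> \<Gamma> ` {-\<delta><..<\<delta>} \<subseteq> C}"

text \<open>The Hessian of the constrained action functional at a critical loop \<open>\<gamma>\<close>, as the mixed second
  derivative along any two-parameter family in \<open>\<H>\<close> through \<open>\<gamma>\<close> with partial derivatives
  \<open>X\<close> and \<open>Y\<close>; at a critical point this does not depend on the family.\<close>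

definition variation2 :: "('m::topological_space, 'e::euclidean_space) chart set \<Rightarrow>
    (real \<Rightarrow> 'm) set \<Rightarrow> (real \<Rightarrow> 'm) \<Rightarrow> (real \<Rightarrow> 'e) \<Rightarrow> (real \<Rightarrow> 'e) \<Rightarrow>
    (real \<Rightarrow> real \<Rightarrow> real \<Rightarrow> 'm) \<Rightarrow> bool" where
  "variation2 A \<H> \<gamma> X Y \<Gamma> \<longleftrightarrow>
     smooth_into A UNIV (\<lambda>(s, \<tau>, t). \<Gamma> s \<tau> t) \<and> (\<forall>s \<tau>. \<Gamma> s \<tau> \<in> \<H>) \<and> \<Gamma> 0 0 = \<gamma> \<and>
     (\<forall>t. velocity A (\<lambda>s. \<Gamma> s 0 t) 0 = X t) \<and> (\<forall>t. velocity A (\<lambda>\<tau>. \<Gamma> 0 \<tau> t) 0 = Y t)"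

definition hessian :: "('m::topological_space, 'e::euclidean_space) chart set \<Rightarrow>
    ('m \<Rightarrow> 'e \<Rightarrow> 'e \<Rightarrow> real) \<Rightarrow> ('m \<Rightarrow> 'e) \<Rightarrow> ('m \<Rightarrow> real) \<Rightarrow>
    (real \<Rightarrow> 'm) \<Rightarrow> (real \<Rightarrow> 'e) \<Rightarrow> (real \<Rightarrow> 'e) \<Rightarrow> real" where
  "hessian A \<omega> \<Lambda> H \<gamma> X Y =
     (THE b. \<forall>\<Gamma>. variation2 A (zero_mean_loops A H) \<gamma> X Y \<Gamma> \<longrightarrow>
        deriv (\<lambda>s. deriv (\<lambda>\<tau>. action A \<omega> \<Lambda> (\<Gamma> s \<tau>)) 0) 0 = b)"

definition morse_bott :: "('m::topological_space, 'e::euclidean_space) chart set \<Rightarrow>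
    ('m \<Rightarrow> 'e \<Rightarrow> 'e \<Rightarrow> real) \<Rightarrow> ('m \<Rightarrow> 'e) \<Rightarrow> ('m \<Rightarrow> real) \<Rightarrow> bool" where
  "morse_bott A \<omega> \<Lambda> H \<longleftrightarrow>
     properly_embedded A (zero_mean_loops A H) (crit A \<omega> H) \<and>
     (\<forall>\<gamma>\<in>crit A \<omega> H. loop_tangent_space A (crit A \<omega> H) \<gamma> =
        {X \<in> zero_mean_tangent A H \<gamma>. \<forall>Y\<in>zero_mean_tangent A H \<gamma>. hessian A \<omega> \<Lambda> H \<gamma> X Y = 0})"

definition flow_lines :: "('m::topological_space, 'e::euclidean_space) chart set \<Rightarrow>
    ('m \<Rightarrow> 'e \<Rightarrow> 'e \<Rightarrow> real) \<Rightarrow> ('m \<Rightarrow> 'e \<Rightarrow> 'e) \<Rightarrow> ('m \<Rightarrow> real) \<Rightarrow>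
    (real \<Rightarrow> 'm) \<Rightarrow> (real \<Rightarrow> 'm) \<Rightarrow> (real \<Rightarrow> real \<Rightarrow> 'm) set" where
  "flow_lines A \<omega> J H x\<^sub>m x\<^sub>p =
     {u. smooth_into A UNIV (\<lambda>(s, t). u s t) \<and> (\<forall>s. u s \<in> zero_mean_loops A H) \<and>
         (\<forall>s t. velocity A (\<lambda>\<sigma>. u \<sigma> t) s = - grad_action A \<omega> J H (u s) t) \<and>
         limitin (loop_topology A 1) u x\<^sub>m at_bot \<and> limitin (loop_topology A 1) u x\<^sub>p at_top}"

end

theory Submission
  imports Defs
begin

text \<open>Let \<open>u\<close> be a flow line and \<open>h = r \<circ> u\<close> where it is outside \<open>W\<close>. There \<open>\<nabla>H = \<Lambda>\<close>, and the
  flow equation gives \<open>\<partial>\<^sub>s h + \<chi> = e\<^bsup>-h\<^esup> \<lambda>(\<partial>\<^sub>t u)\<close> and \<open>\<partial>\<^sub>t h = - e\<^bsup>-h\<^esup> \<lambda>(\<partial>\<^sub>s u)\<close>, so that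
  \<open>\<Delta>h + \<chi>' = e\<^bsup>-h\<^esup> \<bar>\<partial>\<^sub>t u\<bar>\<^sup>2 - (\<partial>\<^sub>s h + \<chi>)\<^sup>2 - (\<partial>\<^sub>t h)\<^sup>2 \<ge> 0\<close> by Bessel's inequality for the orthogonal
  pair \<open>\<Lambda>, R\<close>: up to a primitive of the bounded function \<open>\<chi>\<close>, \<open>h\<close> is subharmonic. Since each loop \<open>u(s)\<close> has
  mean value \<open>0\<close> under \<open>H\<close>, the integral of \<open>H = e\<^sup>r - 1\<close> over the part outside \<open>W\<close> is at most the maximum of
  \<open>\<bar>H\<bar>\<close> on \<open>W\<close>. A local maximum principle turns this integral bound into a pointwise bound of \<open>h\<close>.
  The mean value condition also makes every loop \<open>u(s)\<close> meet \<open>\<Sigma>\<close>, whence the continuity of \<open>\<chi>\<close> along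
  \<open>u\<close>.\<close>

section \<open>Calculus of one and two real variables\<close>

text \<open>At \<open>0\<close> the difference quotient is \<open>max 0 h ^ Suc n\<close>, which
  tends to \<open>0\<close> because the exponent is at least one. Used for the exponents 2, 3 and
  4.\<close>

lemma has_real_derivative_pos_part_power:
  "((\<lambda>x::real. max 0 x ^ Suc (Suc n)) has_real_derivative real (Suc (Suc n)) * max 0 x ^ Suc n) (at x)"
proof -
  consider "x < 0" | "x = 0" | "x > 0" by linarith
  then show ?thesis
  proof cases
    case 1
    have "((\<lambda>x::real. max 0 x ^ Suc (Suc n)) has_real_derivative 0) (at x)"
    proof (rule has_field_derivative_transform_within_open[of "\<lambda>x. 0" _ _ "{..<0}"])
    qed (use 1 in \<open>auto simp: max_def\<close>)
    with 1 show ?thesis by (simp add: max_def)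
  next
    case 2
    have "(\<lambda>h::real. max 0 h ^ Suc n) \<midarrow>0\<rightarrow> max 0 0 ^ Suc n"
      by (intro tendsto_intros)
    then have "(\<lambda>h::real. max 0 h ^ Suc n) \<midarrow>0\<rightarrow> 0" by simp
    then have "(\<lambda>h::real. (max 0 (0 + h) ^ Suc (Suc n) - max 0 0 ^ Suc (Suc n)) / h) \<midarrow>0\<rightarrow> 0"
      by (rule Lim_transform_eventually) (auto simp: eventually_at_filter max_def)
    with 2 show ?thesis by (simp add: DERIV_def)
  next
    case 3
    have "((\<lambda>x::real. max 0 x ^ Suc (Suc n)) has_real_derivative
            real (Suc (Suc n)) * x ^ Suc n) (at x)"
    proof (rule has_field_derivative_transform_within_open[of "\<lambda>x. x ^ Suc (Suc n)" _ _ "{0<..}"])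
      show "((\<lambda>x. x ^ Suc (Suc n)) has_real_derivative real (Suc (Suc n)) * x ^ Suc n) (at x)"
        using DERIV_pow[of "Suc (Suc n)" x] by simp
    qed (use 3 in auto)
    with 3 show ?thesis by simp
  qed
qed

text \<open>If \<open>D\<close> were positive, \<open>f'\<close> would be positive just to the right
  of its zero \<open>x\<close>, and by the mean value theorem \<open>f\<close> would rise above its
  maximum.\<close>

lemma second_derivative_nonpos_at_max:
  fixes f f' :: "real \<Rightarrow> real"
  assumes "0 < d"
    and f: "\<And>y. \<bar>y - x\<bar> < d \<Longrightarrow> (f has_real_derivative f' y) (at y)"
    and f': "(f' has_real_derivative D) (at x)"
    and max: "\<And>y. \<bar>y - x\<bar> < d \<Longrightarrow> f y \<le> f x"
  shows "D \<le> 0"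
proof (rule ccontr)
  assume "\<not> D \<le> 0"
  have "f' x = 0"
    by (rule DERIV_local_max[OF f \<open>0 < d\<close>]) (use \<open>0 < d\<close> max in \<open>auto simp: abs_minus_commute\<close>)
  moreover obtain e where e: "e > 0" "\<And>h. 0 < h \<Longrightarrow> h < e \<Longrightarrow> f' x < f' (x + h)"
    using DERIV_pos_inc_right[OF f'] \<open>\<not> D \<le> 0\<close> by auto
  define y where "y = x + min d e / 2"
  have y: "x < y" "y - x < d" "y - x < e"
    using \<open>0 < d\<close> e(1) by (auto simp: y_def min_def field_simps)
  obtain z where z: "x < z" "z < y" "f y - f x = (y - x) * f' z"
    using MVT2[of x y f f'] f y by force
  have "f' z > 0"
    using e(2)[of "z - x"] z y \<open>f' x = 0\<close> by auto
  then have "f y > f x"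
    using z y by (smt (verit) mult_pos_pos)
  with max[of y] y show False by auto
qed

text \<open>Two mean value theorems, for the increment \<open>f (x + d) - f x\<close> and then for
  \<open>f'\<close>. It serves to find points where the second derivative is controlled by values of
  the function alone.\<close>

lemma second_difference_mvt:
  fixes f f' f'' :: "real \<Rightarrow> real"
  assumes "0 < d"
    and f: "\<And>x. a \<le> x \<Longrightarrow> x \<le> a + 2 * d \<Longrightarrow> (f has_real_derivative f' x) (at x)"
    and f': "\<And>x. a \<le> x \<Longrightarrow> x \<le> a + 2 * d \<Longrightarrow> (f' has_real_derivative f'' x) (at x)"
  obtains x where "a < x" "x < a + 2 * d" "f (a + 2 * d) - 2 * f (a + d) + f a = d\<^sup>2 * f'' x"
proof -
  have "\<exists>z>a. z < a + d \<and> (f (a + d + d) - f (a + d)) - (f (a + d) - f a) =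
      (a + d - a) * (f' (z + d) - f' z)"
    using \<open>0 < d\<close> f
    by (intro MVT2[of a "a + d" "\<lambda>x. f (x + d) - f x" "\<lambda>x. f' (x + d) - f' x"])
       (auto intro!: DERIV_diff simp: DERIV_shift[symmetric])
  then obtain z where z: "a < z" "z < a + d"
    "(f (a + d + d) - f (a + d)) - (f (a + d) - f a) = d * (f' (z + d) - f' z)"
    by auto
  obtain x where x: "z < x" "x < z + d" "f' (z + d) - f' z = d * f'' x"
    using MVT2[of z "z + d" f' f''] f' \<open>0 < d\<close> z by force
  show thesis
    by (rule that[of x]) (use x z in \<open>auto simp: power2_eq_square algebra_simps\<close>)
qed

text \<open>Schwarz's theorem. The second increment over a small square of side \<open>h\<close> is
  \<open>h * h\<close> times a value of either mixed derivative, and continuity at the corner brings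
  both values close to those at \<open>(a, b)\<close>.\<close>

lemma mixed_partials_eq:
  fixes f f\<^sub>1 f\<^sub>2 f\<^sub>1\<^sub>2 f\<^sub>2\<^sub>1 :: "real \<Rightarrow> real \<Rightarrow> real"
  assumes "0 < d"
    and 1: "\<And>x y. \<bar>x - a\<bar> < d \<Longrightarrow> \<bar>y - b\<bar> < d \<Longrightarrow> ((\<lambda>x. f x y) has_real_derivative f\<^sub>1 x y) (at x)"
    and 2: "\<And>x y. \<bar>x - a\<bar> < d \<Longrightarrow> \<bar>y - b\<bar> < d \<Longrightarrow> ((\<lambda>y. f x y) has_real_derivative f\<^sub>2 x y) (at y)"
    and 12: "\<And>x y. \<bar>x - a\<bar> < d \<Longrightarrow> \<bar>y - b\<bar> < d \<Longrightarrow> ((\<lambda>y. f\<^sub>1 x y) has_real_derivative f\<^sub>1\<^sub>2 x y) (at y)"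
    and 21: "\<And>x y. \<bar>x - a\<bar> < d \<Longrightarrow> \<bar>y - b\<bar> < d \<Longrightarrow> ((\<lambda>x. f\<^sub>2 x y) has_real_derivative f\<^sub>2\<^sub>1 x y) (at x)"
    and cont: "isCont (\<lambda>(x, y). f\<^sub>1\<^sub>2 x y) (a, b)" "isCont (\<lambda>(x, y). f\<^sub>2\<^sub>1 x y) (a, b)"
  shows "f\<^sub>1\<^sub>2 a b = f\<^sub>2\<^sub>1 a b"
proof (rule ccontr)
  assume neq: "f\<^sub>1\<^sub>2 a b \<noteq> f\<^sub>2\<^sub>1 a b"
  define e where "e = \<bar>f\<^sub>1\<^sub>2 a b - f\<^sub>2\<^sub>1 a b\<bar> / 2"
  have "e > 0" using neq by (auto simp: e_def)
  obtain d1 where d1: "d1 > 0" "\<And>z. dist z (a, b) < d1 \<Longrightarrow> dist (case z of (x, y) \<Rightarrow> f\<^sub>1\<^sub>2 x y) (f\<^sub>1\<^sub>2 a b) < e"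
    using cont(1) \<open>e > 0\<close> unfolding continuous_at_eps_delta by force
  obtain d2 where d2: "d2 > 0" "\<And>z. dist z (a, b) < d2 \<Longrightarrow> dist (case z of (x, y) \<Rightarrow> f\<^sub>2\<^sub>1 x y) (f\<^sub>2\<^sub>1 a b) < e"
    using cont(2) \<open>e > 0\<close> unfolding continuous_at_eps_delta by force
  define h where "h = min d (min d1 d2) / 3"
  have h: "0 < h" "h < d" "2 * h < d1" "2 * h < d2"
    using \<open>0 < d\<close> d1(1) d2(1) by (auto simp: h_def min_def field_simps)
  have near: "dist (x, y) (a, b) < 2 * h" if "a < x" "x < a + h" "b < y" "y < b + h" for x y
  proof -
    have "dist (x, y) (a, b) \<le> dist x a + dist y b"
      unfolding dist_Pair_Pair by (rule sqrt_sum_squares_le_sum) auto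
    also have "\<dots> < 2 * h" using that by (auto simp: dist_real_def)
    finally show ?thesis .
  qed
  have "\<exists>x>a. x < a + h \<and> (f (a + h) (b + h) - f (a + h) b) - (f a (b + h) - f a b)
      = (a + h - a) * (f\<^sub>1 x (b + h) - f\<^sub>1 x b)"
    using h 1 by (intro MVT2[of a "a + h" "\<lambda>x. f x (b + h) - f x b"]) (auto intro!: derivative_intros)
  then obtain x where x: "a < x" "x < a + h"
    "(f (a + h) (b + h) - f (a + h) b) - (f a (b + h) - f a b) = h * (f\<^sub>1 x (b + h) - f\<^sub>1 x b)" by auto
  have "\<exists>y>b. y < b + h \<and> f\<^sub>1 x (b + h) - f\<^sub>1 x b = (b + h - b) * f\<^sub>1\<^sub>2 x y"
    using h x 12 by (intro MVT2) auto
  then obtain y where y: "b < y" "y < b + h" "f\<^sub>1 x (b + h) - f\<^sub>1 x b = h * f\<^sub>1\<^sub>2 x y" by auto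
  have "\<exists>y>b. y < b + h \<and> (f (a + h) (b + h) - f a (b + h)) - (f (a + h) b - f a b)
      = (b + h - b) * (f\<^sub>2 (a + h) y - f\<^sub>2 a y)"
    using h 2 by (intro MVT2[of b "b + h" "\<lambda>y. f (a + h) y - f a y"]) (auto intro!: derivative_intros)
  then obtain y' where y': "b < y'" "y' < b + h"
    "(f (a + h) (b + h) - f a (b + h)) - (f (a + h) b - f a b) = h * (f\<^sub>2 (a + h) y' - f\<^sub>2 a y')" by auto
  have "\<exists>x>a. x < a + h \<and> f\<^sub>2 (a + h) y' - f\<^sub>2 a y' = (a + h - a) * f\<^sub>2\<^sub>1 x y'"
    using h y' 21 by (intro MVT2) auto
  then obtain x' where x': "a < x'" "x' < a + h" "f\<^sub>2 (a + h) y' - f\<^sub>2 a y' = h * f\<^sub>2\<^sub>1 x' y'" by auto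
  have "h * (h * f\<^sub>1\<^sub>2 x y) = h * (h * f\<^sub>2\<^sub>1 x' y')"
    using x(3) y(3) y'(3) x'(3) by (simp add: algebra_simps)
  then have eq: "f\<^sub>1\<^sub>2 x y = f\<^sub>2\<^sub>1 x' y'" using h(1) by simp
  have "dist (f\<^sub>1\<^sub>2 x y) (f\<^sub>1\<^sub>2 a b) < e"
    using d1(2)[of "(x, y)"] near[of x y] x y h by simp
  moreover have "dist (f\<^sub>2\<^sub>1 x' y') (f\<^sub>2\<^sub>1 a b) < e"
    using d2(2)[of "(x', y')"] near[of x' y'] x' y' h by simp
  ultimately show False
    using eq by (simp add: e_def dist_real_def) (smt (verit) field_sum_of_halves)
qed

section \<open>A maximum principle on periodic strips\<close>

text \<open>Keep the terms of order 0 and 4 of the exponential series; 24 is the factorial of 4. A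
  bound on the integral of \<open>exp k - 1\<close> thus bounds that of
  \<open>k ^ 4\<close>.\<close>

lemma pow4_le_exp: "(x::real) ^ 4 \<le> 24 * (exp x - 1)" if "0 \<le> x"
proof -
  have "(\<Sum>n\<in>{0,4}. x ^ n /\<^sub>R fact n) \<le> (\<Sum>n. x ^ n /\<^sub>R fact n)"
    by (rule sum_le_suminf) (use that summable_exp_generic[of x] in auto)
  then have "1 + x ^ 4 / 24 \<le> exp x"
    by (simp add: exp_def fact_numeral field_simps)
  then show ?thesis by simp
qed

text \<open>Write \<open>\<eta> = F'\<close> and \<open>w = (max 0 (k + F - const))\<^sup>4\<close>; the fourth power makes \<open>w\<close> a subharmonic
  function of class \<open>C\<^sup>2\<close>. As the integral of \<open>w\<close> over slices is bounded, the second derivative of this integral is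
  bounded for some \<open>s\<close> on either side of \<open>s\<^sub>0\<close>. It controls \<open>\<integral>(\<partial>\<^sub>t \<surd>w)\<^sup>2\<close>, hence the
  supremum of \<open>w\<close> over these two slices; the maximum principle carries the bound over to \<open>s\<^sub>0\<close>.\<close>

lemma subharmonic_strip_bound:
  fixes k a b a' b' :: "real \<Rightarrow> real \<Rightarrow> real" and \<eta> :: "real \<Rightarrow> real"
  defines "\<Omega> \<equiv> {x. 0 < k (fst x) (snd x)}"
  assumes k_cont: "continuous_on UNIV (\<lambda>x. k (fst x) (snd x))"
    and k_nonneg: "\<And>s t. 0 \<le> k s t"
    and k_periodic: "\<And>s t. k s (t + 1) = k s t"
    and k_zero: "\<And>s. \<exists>t\<in>{0..1}. k s t = 0"
    and k_int: "\<And>s. integral {0..1} (\<lambda>t. exp (k s t) - 1) \<le> m"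
    and \<eta>_cont: "continuous_on UNIV \<eta>"
    and \<eta>_bound: "\<And>s. \<bar>\<eta> s\<bar> \<le> C"
    and ks: "\<And>s t. 0 < k s t \<Longrightarrow> ((\<lambda>s. k s t) has_real_derivative a s t - \<eta> s) (at s)"
    and kt: "\<And>s t. 0 < k s t \<Longrightarrow> ((\<lambda>t. k s t) has_real_derivative - b s t) (at t)"
    and as: "\<And>s t. 0 < k s t \<Longrightarrow> ((\<lambda>s. a s t) has_real_derivative a' s t) (at s)"
    and bt: "\<And>s t. 0 < k s t \<Longrightarrow> ((\<lambda>t. b s t) has_real_derivative b' s t) (at t)"
    and cont: "continuous_on \<Omega> (\<lambda>x. a (fst x) (snd x))" "continuous_on \<Omega> (\<lambda>x. b (fst x) (snd x))"
      "continuous_on \<Omega> (\<lambda>x. a' (fst x) (snd x))" "continuous_on \<Omega> (\<lambda>x. b' (fst x) (snd x))"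
    and laplace: "\<And>s t. 0 < k s t \<Longrightarrow> 0 \<le> a' s t - b' s t"
  shows "k s\<^sub>0 t\<^sub>0 \<le> 2 * C + 3 + 32 * m"
proof -

  \<comment> \<open>A primitive of \<open>\<eta>\<close> and the truncation \<open>P\<close>\<close>
  have "open \<Omega>"
    unfolding \<Omega>_def using open_Collect_less[OF continuous_on_const k_cont, of 0] by simp
  have "C \<ge> 0" using \<eta>_bound[of 0] by linarith
  \<comment> \<open>The interval of radius 3 has the interval of radius 2 in its interior, so that
    derivatives within it become full derivatives there.\<close>
  obtain G where G: "\<And>s. s \<in> {s\<^sub>0 - 3..s\<^sub>0 + 3} \<Longrightarrow> (G has_vector_derivative \<eta> s) (at s within {s\<^sub>0 - 3..s\<^sub>0 + 3})"
    using antiderivative_continuous[OF continuous_on_subset[OF \<eta>_cont subset_UNIV]] by metis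
  define F where "F s = G s - G s\<^sub>0" for s
  define D where "D = {s\<^sub>0 - 2<..<s\<^sub>0 + 2}"
  have F: "(F has_real_derivative \<eta> s) (at s)" if "\<bar>s - s\<^sub>0\<bar> \<le> 2" for s
  proof -
    have "(G has_real_derivative \<eta> s) (at s within {s\<^sub>0 - 3<..<s\<^sub>0 + 3})"
      using G[of s] that
      by (intro DERIV_subset[where t="{s\<^sub>0 - 3<..<s\<^sub>0 + 3}" and s="{s\<^sub>0 - 3..s\<^sub>0 + 3}"])
         (auto simp: has_real_derivative_iff_has_vector_derivative abs_le_iff)
    then have "(G has_real_derivative \<eta> s) (at s)"
      using at_within_open[of s "{s\<^sub>0 - 3<..<s\<^sub>0 + 3}"] that by (auto simp: abs_le_iff)
    then show ?thesis unfolding F_def by (auto intro!: derivative_eq_intros)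
  qed
  have "F s\<^sub>0 = 0" by (simp add: F_def)
  have F_le: "F s \<le> 2 * C" if "s \<in> D" for s
  proof -
    have "norm (F s - F s\<^sub>0) \<le> C * norm (s - s\<^sub>0)"
    proof (rule field_differentiable_bound[where S = "{s\<^sub>0 - 2..s\<^sub>0 + 2}"])
      show "(F has_field_derivative \<eta> z) (at z within {s\<^sub>0 - 2..s\<^sub>0 + 2})" if "z \<in> {s\<^sub>0 - 2..s\<^sub>0 + 2}" for z
        using F[of z] that by (auto intro: has_field_derivative_at_within)
    qed (use \<eta>_bound that in \<open>auto simp: D_def\<close>)
    also have "\<dots> \<le> C * 2"
      using that \<open>C \<ge> 0\<close> by (intro mult_left_mono) (auto simp: D_def)
    finally show ?thesis by (simp add: \<open>F s\<^sub>0 = 0\<close>)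
  qed
  \<comment> \<open>Adding \<open>F\<close> cancels \<open>- \<eta>\<close> in the derivative of
    \<open>k\<close>. As \<open>F s \<le> 2 * C\<close> on \<open>D\<close>, subtracting
    \<open>2 * C + 1\<close> makes \<open>P\<close> vanish wherever \<open>k < 1\<close>, hence near
    every zero of \<open>k\<close>, where nothing is known about \<open>a\<close> and
    \<open>b\<close>.\<close>
  define P where "P s t = max 0 (k s t + F s - (2 * C + 1))" for s t
  have P_nonneg: "0 \<le> P s t" for s t by (simp add: P_def)
  have P_le: "P s t \<le> k s t" if "s \<in> D" for s t
    using F_le[OF that] k_nonneg[of s t] by (auto simp: P_def)
  have P_periodic: "P s (t + 1) = P s t" for s t by (simp add: P_def k_periodic)
  have P_frac: "P s (frac t) = P s t" for s t
  proof -
    have "P s (\<tau> + of_int n) = P s \<tau>" for \<tau> n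
    proof (induction n rule: int_induct[where k=0])
      case (step1 i)
      then show ?case using P_periodic[of s "\<tau> + of_int i"] by (simp add: add.assoc)
    next
      case (step2 i)
      then show ?case using P_periodic[of s "\<tau> + of_int (i - 1)"] by (simp add: algebra_simps)
    qed simp
    from this[of "frac t" "\<lfloor>t\<rfloor>"] show ?thesis by (simp add: frac_def)
  qed
  have P_zero: "P s t = 0" if "s \<in> D" "k s t = 0" for s t
    using P_le[OF that(1), of t] P_nonneg[of s t] that(2) by linarith
  have "open (D \<times> (UNIV :: real set))" "open D" by (auto simp: D_def open_Times)
  have F_cont: "continuous_on D F"
    by (intro continuous_at_imp_continuous_on ballI DERIV_isCont[OF F]) (auto simp: D_def abs_le_iff)
  have P_cont: "continuous_on (D \<times> UNIV) (\<lambda>x. P (fst x) (snd x))"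
    unfolding P_def
    by (intro continuous_intros continuous_on_compose2[OF F_cont] continuous_on_subset[OF k_cont]) auto
  have P_ev: "\<forall>\<^sub>F y in nhds x. P (fst y) (snd y) = 0"
    if "x \<in> D \<times> UNIV" "k (fst x) (snd x) = 0" for x
  proof -
    have "open ({y. k (fst y) (snd y) < 1} \<inter> D \<times> UNIV)"
      by (intro open_Int \<open>open (D \<times> UNIV)\<close> open_Collect_less[OF k_cont continuous_on_const])
    moreover have "P (fst y) (snd y) = 0" if "y \<in> {y. k (fst y) (snd y) < 1} \<inter> D \<times> UNIV" for y
      using that F_le[of "fst y"] by (auto simp: P_def)
    ultimately show ?thesis
      using that by (auto simp: eventually_nhds intro!: exI[of _ "{y. k (fst y) (snd y) < 1} \<inter> D \<times> UNIV"])
  qed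
  have P_ev1: "\<forall>\<^sub>F \<sigma> in nhds s. P \<sigma> t = 0" and P_ev2: "\<forall>\<^sub>F \<tau> in nhds t. P s \<tau> = 0"
    if "s \<in> D" "k s t = 0" for s t
  proof -
    have "((\<lambda>\<sigma>. (\<sigma>, t)) \<longlongrightarrow> (s, t)) (nhds s)" "((\<lambda>\<tau>. (s, \<tau>)) \<longlongrightarrow> (s, t)) (nhds t)"
      by (auto intro!: tendsto_intros simp: tendsto_ident_at filterlim_ident)
    then show "\<forall>\<^sub>F \<sigma> in nhds s. P \<sigma> t = 0" "\<forall>\<^sub>F \<tau> in nhds t. P s \<tau> = 0"
      using P_ev[of "(s, t)"] that unfolding filterlim_iff by force+
  qed
  \<comment> \<open>\<open>c\<close> is arbitrary outside \<open>\<Omega>\<close>, but the product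
    is locally zero there and so stays continuous across the boundary of
    \<open>\<Omega>\<close>.\<close>
  have prod_cont: "continuous_on (D \<times> UNIV) (\<lambda>x. P (fst x) (snd x) ^ Suc n * c x)"
    if "continuous_on \<Omega> c" for c n
  proof (rule continuous_at_imp_continuous_on, rule ballI)
    fix x :: "real \<times> real" assume x: "x \<in> D \<times> UNIV"
    show "isCont (\<lambda>x. P (fst x) (snd x) ^ Suc n * c x) x"
    proof (cases "x \<in> \<Omega>")
      case True
      then have "isCont c x" using that \<open>open \<Omega>\<close> by (simp add: continuous_on_eq_continuous_at)
      moreover have "isCont (\<lambda>x. P (fst x) (snd x)) x"
        using P_cont x continuous_on_eq_continuous_at[OF \<open>open (D \<times> UNIV)\<close>] by blast
      ultimately show ?thesis by (intro continuous_intros)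
    next
      case False
      then have "k (fst x) (snd x) = 0" using k_nonneg[of "fst x" "snd x"] by (auto simp: \<Omega>_def)
      from P_ev[OF x this] have "\<forall>\<^sub>F y in nhds x. P (fst y) (snd y) ^ Suc n * c y = 0"
        by eventually_elim simp
      then have "isCont (\<lambda>x. P (fst x) (snd x) ^ Suc n * c x) x = isCont (\<lambda>x. 0 :: real) x"
        by (rule isCont_cong)
      then show ?thesis by simp
    qed
  qed
  have Ps: "((\<lambda>\<sigma>. P \<sigma> t ^ Suc (Suc n)) has_real_derivative real (Suc (Suc n)) * (P s t ^ Suc n * a s t)) (at s)"
    if "s \<in> D" for s t n
  proof (cases "k s t = 0")
    case True
    from P_ev1[OF that True] have "\<forall>\<^sub>F \<sigma> in nhds s. P \<sigma> t ^ Suc (Suc n) = 0"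
      by eventually_elim simp
    then show ?thesis
      using P_zero[OF that True] by (subst DERIV_cong_ev[OF refl _ refl, where g="\<lambda>_. 0"]) auto
  next
    case False
    then have "0 < k s t" using k_nonneg[of s t] by simp
    then have "((\<lambda>\<sigma>. k \<sigma> t + F \<sigma> - (2 * C + 1)) has_real_derivative a s t) (at s)"
      using ks[of s t] F[of s] that by (auto intro!: derivative_eq_intros simp: D_def abs_le_iff)
    from DERIV_chain2[OF has_real_derivative_pos_part_power this] show ?thesis
      unfolding P_def by (simp only: mult.assoc)
  qed
  have Pt: "((\<lambda>\<tau>. P s \<tau> ^ Suc (Suc n)) has_real_derivative - real (Suc (Suc n)) * (P s t ^ Suc n * b s t)) (at t)"
    if "s \<in> D" for s t n
  proof (cases "k s t = 0")
    case True
    from P_ev2[OF that True] have "\<forall>\<^sub>F \<tau> in nhds t. P s \<tau> ^ Suc (Suc n) = 0"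
      by eventually_elim simp
    then show ?thesis
      using P_zero[OF that True] by (subst DERIV_cong_ev[OF refl _ refl, where g="\<lambda>_. 0"]) auto
  next
    case False
    then have "0 < k s t" using k_nonneg[of s t] by simp
    then have "((\<lambda>\<tau>. k s \<tau> + F s - (2 * C + 1)) has_real_derivative - b s t) (at t)"
      using kt[of s t] by (auto intro!: derivative_eq_intros)
    from DERIV_chain2[OF has_real_derivative_pos_part_power this] show ?thesis
      unfolding P_def by (simp only: mult.assoc mult_minus_left mult_minus_right)
  qed

  \<comment> \<open>The function \<open>w\<close>, its derivatives and its subharmonicity\<close>
  define w where "w s t = P s t ^ 4" for s t
  define ws where "ws s t = 4 * (P s t ^ 3 * a s t)" for s t
  define wss where "wss s t = 12 * (P s t ^ 2 * (a s t)\<^sup>2) + 4 * (P s t ^ 3 * a' s t)" for s t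
  define wt where "wt s t = - 4 * (P s t ^ 3 * b s t)" for s t
  define wtt where "wtt s t = 12 * (P s t ^ 2 * (b s t)\<^sup>2) - 4 * (P s t ^ 3 * b' s t)" for s t
  have w_s: "((\<lambda>s. w s t) has_real_derivative ws s t) (at s)" if "s \<in> D" for s t
    using Ps[OF that, of t 2] by (simp add: w_def ws_def eval_nat_numeral)
  have w_t: "((\<lambda>t. w s t) has_real_derivative wt s t) (at t)" if "s \<in> D" for s t
    using Pt[OF that, of 2 t] by (simp add: w_def wt_def eval_nat_numeral)
  have w_ss: "((\<lambda>s. ws s t) has_real_derivative wss s t) (at s)" if "s \<in> D" for s t
  proof (cases "k s t = 0")
    case True
    from P_ev1[OF that True] have "\<forall>\<^sub>F \<sigma> in nhds s. ws \<sigma> t = 0"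
      by eventually_elim (simp add: ws_def)
    then show ?thesis
      using P_zero[OF that True] by (subst DERIV_cong_ev[OF refl _ refl, where g="\<lambda>_. 0"]) (auto simp: wss_def)
  next
    case False
    then have "0 < k s t" using k_nonneg[of s t] by simp
    have "((\<lambda>s. P s t ^ 3) has_real_derivative 3 * (P s t ^ 2 * a s t)) (at s)"
      using Ps[OF that, of t 1] by (simp add: eval_nat_numeral)
    from DERIV_cmult[OF DERIV_mult[OF this as[OF \<open>0 < k s t\<close>]], of 4] show ?thesis
      unfolding ws_def wss_def by (simp add: power2_eq_square algebra_simps)
  qed
  have w_tt: "((\<lambda>t. wt s t) has_real_derivative wtt s t) (at t)" if "s \<in> D" for s t
  proof (cases "k s t = 0")
    case True
    from P_ev2[OF that True] have "\<forall>\<^sub>F \<tau> in nhds t. wt s \<tau> = 0"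
      by eventually_elim (simp add: wt_def)
    then show ?thesis
      using P_zero[OF that True] by (subst DERIV_cong_ev[OF refl _ refl, where g="\<lambda>_. 0"]) (auto simp: wtt_def)
  next
    case False
    then have "0 < k s t" using k_nonneg[of s t] by simp
    have "((\<lambda>t. P s t ^ 3) has_real_derivative - 3 * (P s t ^ 2 * b s t)) (at t)"
      using Pt[OF that, of 1 t] by (simp add: eval_nat_numeral)
    from DERIV_cmult[OF DERIV_mult[OF this bt[OF \<open>0 < k s t\<close>]], of "- 4"] show ?thesis
      unfolding wt_def wtt_def by (simp add: power2_eq_square algebra_simps)
  qed
  have wt_periodic: "wt s (t + 1) = wt s t" if "s \<in> D" for s t
  proof -
    have "((\<lambda>t. w s t) has_real_derivative wt s (t + 1)) (at t)"
      using w_t[OF that, of "t + 1"] by (simp add: DERIV_shift w_def P_periodic)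
    with w_t[OF that, of t] show ?thesis by (rule DERIV_unique[OF _ _, symmetric])
  qed
  \<comment> \<open>The sum is \<open>12 * P ^ 2\<close> times the squares of \<open>a\<close> and
    \<open>b\<close>, plus \<open>4 * P ^ 3\<close> times \<open>a' - b' \<ge> 0\<close>. The square
    of \<open>b\<close> is retained because its term is three times the squared
    \<open>t\<close>-derivative of \<open>P ^ 2\<close>.\<close>
  have lap: "12 * (P s t ^ 2 * (b s t)\<^sup>2) \<le> wss s t + wtt s t" if "s \<in> D" for s t
  proof -
    have "0 \<le> P s t ^ 3 * (a' s t - b' s t)"
      using laplace[of s t] k_nonneg[of s t] P_nonneg[of s t] P_zero[OF that, of t]
      by (cases "k s t = 0") auto
    moreover have "0 \<le> P s t ^ 2 * (a s t)\<^sup>2" by simp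
    moreover have "wss s t + wtt s t = 12 * (P s t ^ 2 * (a s t)\<^sup>2) + 12 * (P s t ^ 2 * (b s t)\<^sup>2)
        + 4 * (P s t ^ 3 * (a' s t - b' s t))"
      unfolding wss_def wtt_def by (simp add: algebra_simps)
    ultimately show ?thesis by linarith
  qed
  have w_cont: "continuous_on (D \<times> UNIV) (\<lambda>x. w (fst x) (snd x))"
    unfolding w_def by (intro continuous_intros P_cont)
  have c3: "continuous_on (D \<times> UNIV) (\<lambda>x. P (fst x) (snd x) ^ 3 * c x)"
    and c2: "continuous_on (D \<times> UNIV) (\<lambda>x. P (fst x) (snd x) ^ 2 * c x)"
    and c1: "continuous_on (D \<times> UNIV) (\<lambda>x. P (fst x) (snd x) * c x)"
    if "continuous_on \<Omega> c" for c
    using prod_cont[OF that, of 2] prod_cont[OF that, of 1] prod_cont[OF that, of 0]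
    by (simp_all only: numeral_3_eq_3 numeral_2_eq_2 One_nat_def power_Suc0_right)
  have ws_cont: "continuous_on (D \<times> UNIV) (\<lambda>x. ws (fst x) (snd x))"
    unfolding ws_def by (intro continuous_intros c3 cont)
  have wss_cont: "continuous_on (D \<times> UNIV) (\<lambda>x. wss (fst x) (snd x))"
    unfolding wss_def by (intro continuous_intros c3 c2 cont)
  have wtt_cont: "continuous_on (D \<times> UNIV) (\<lambda>x. wtt (fst x) (snd x))"
    unfolding wtt_def by (intro continuous_intros c3 c2 cont)
  have slice: "continuous_on S (\<lambda>t. f s t)"
    if "continuous_on (D \<times> UNIV) (\<lambda>x. f (fst x) (snd x))" "s \<in> D" for f :: "real \<Rightarrow> real \<Rightarrow> real" and s S
    by (rule continuous_on_compose2[OF that(1), where f="\<lambda>t. (s, t)", simplified])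
       (use that(2) in \<open>auto intro!: continuous_intros\<close>)

  \<comment> \<open>Integrals over the slices\<close>
  define I where "I s = integral {0..1} (w s)" for s
  define I' where "I' s = integral {0..1} (ws s)" for s
  define I'' where "I'' s = integral {0..1} (wss s)" for s
  have leibniz: "((\<lambda>s. integral {0..1} (f s)) has_real_derivative integral {0..1} (f' s)) (at s)"
    if "\<And>s t. s \<in> D \<Longrightarrow> ((\<lambda>s. f s t) has_real_derivative f' s t) (at s)"
      "continuous_on (D \<times> UNIV) (\<lambda>x. f (fst x) (snd x))"
      "continuous_on (D \<times> UNIV) (\<lambda>x. f' (fst x) (snd x))" "s \<in> D" for f f' :: "real \<Rightarrow> real \<Rightarrow> real" and s
  proof -
    have "((\<lambda>s. integral (cbox 0 1) (f s)) has_real_derivative integral (cbox 0 1) (f' s)) (at s within D)"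
    proof (rule leibniz_rule_field_derivative)
      show "f s integrable_on cbox 0 1" if "s \<in> D" for s
        using slice[OF \<open>continuous_on (D \<times> UNIV) (\<lambda>x. f (fst x) (snd x))\<close> that]
        by (auto intro: integrable_continuous_interval)
      show "continuous_on (D \<times> cbox 0 1) (\<lambda>(s, t). f' s t)"
        using that(3) by (auto simp: case_prod_beta intro: continuous_on_subset)
    qed (use that in \<open>auto simp: D_def intro: has_field_derivative_at_within\<close>)
    then show ?thesis
      using at_within_open[OF \<open>s \<in> D\<close> \<open>open D\<close>] by simp
  qed
  have I: "(I has_real_derivative I' s) (at s)" if "s \<in> D" for s
    unfolding I_def I'_def by (rule leibniz[OF w_s w_cont ws_cont that])
  have I': "(I' has_real_derivative I'' s) (at s)" if "s \<in> D" for s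
    unfolding I'_def I''_def by (rule leibniz[OF w_ss ws_cont wss_cont that])
  \<comment> \<open>The integral of a non-integrable function is \<open>0\<close> by convention, so
    this holds for every \<open>s\<close>, also outside \<open>D\<close>.\<close>
  have I_nonneg: "0 \<le> I s" for s
    unfolding I_def by (cases "w s integrable_on {0..1}") (auto simp: w_def integral_nonneg not_integrable_integral)
  have I_le: "I s \<le> 24 * m" if "s \<in> D" for s
  proof -
    have ks_cont: "continuous_on {0..1} (k s)"
      by (rule continuous_on_compose2[OF k_cont, where f="\<lambda>t. (s, t)", simplified])
         (auto intro!: continuous_intros)
    have "I s \<le> integral {0..1} (\<lambda>t. 24 * (exp (k s t) - 1))"
      unfolding I_def
    proof (rule integral_le)
      fix t
      have "w s t \<le> k s t ^ 4" unfolding w_def using P_le[OF that] P_nonneg by (intro power_mono)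
      also have "\<dots> \<le> 24 * (exp (k s t) - 1)" by (rule pow4_le_exp[OF k_nonneg])
      finally show "w s t \<le> 24 * (exp (k s t) - 1)" .
    qed (auto intro!: integrable_continuous_interval continuous_intros ks_cont slice[OF w_cont that])
    also have "\<dots> = 24 * integral {0..1} (\<lambda>t. exp (k s t) - 1)" by (rule integral_mult_right)
    also have "\<dots> \<le> 24 * m" using k_int[of s] by simp
    finally show ?thesis .
  qed

  \<comment> \<open>Supremum bound on slices where \<open>I''\<close> is controlled\<close>
  have "m \<ge> 0" using I_nonneg[of s\<^sub>0] I_le[of s\<^sub>0] by (simp add: D_def)
  \<comment> \<open>From \<open>\<bar>x\<bar> \<le> 1 / 2 + x\<^sup>2 / 2\<close>, integrated over a
    period for \<open>x\<close> the \<open>t\<close>-derivative of \<open>P ^ 2\<close>, whose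
    square has integral at most \<open>64 * m\<close> on a good slice.\<close>
  define B where "B = 1 / 2 + 32 * m"
  have P_bound: "(P s t)\<^sup>2 \<le> B" if "s \<in> D" "I'' s \<le> 192 * m" for s t
  proof -
    define pt where "pt t = - 2 * (P s t * b s t)" for t
    have p_t: "((\<lambda>t. (P s t)\<^sup>2) has_real_derivative pt t) (at t)" for t
      using Pt[OF that(1), of 0 t] by (simp add: pt_def eval_nat_numeral)
    have pt_cont: "continuous_on S pt" for S
      unfolding pt_def
      by (intro continuous_intros slice[of "\<lambda>s t. P s t * b s t", OF _ that(1)] c1 cont)
    \<comment> \<open>By periodicity of \<open>wt\<close> the \<open>t\<close>-part of the Laplacian
      integrates to zero over a period, so that integrating \<open>lap\<close> leaves only
      \<open>I'' s\<close> on the right.\<close>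
    have "(wtt s has_integral wt s 1 - wt s 0) {0..1}"
      using w_tt[OF that(1)]
      by (intro fundamental_theorem_of_calculus)
         (auto simp: has_real_derivative_iff_has_vector_derivative[symmetric] intro: has_field_derivative_at_within)
    then have "integral {0..1} (wtt s) = 0"
      using wt_periodic[OF that(1), of 0] by (simp add: integral_unique)
    have "integral {0..1} (\<lambda>t. 3 * (pt t)\<^sup>2) \<le> integral {0..1} (\<lambda>t. wss s t + wtt s t)"
      using lap[OF that(1)]
      by (intro integral_le integrable_continuous_interval continuous_intros pt_cont
            slice[OF wss_cont that(1)] slice[OF wtt_cont that(1)])
         (auto simp: pt_def power_mult_distrib)
    also have "\<dots> = I'' s"
      unfolding I''_def using \<open>integral {0..1} (wtt s) = 0\<close>
      by (subst integral_add)
         (auto intro!: integrable_continuous_interval slice[OF wss_cont that(1)] slice[OF wtt_cont that(1)])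
    finally have "integral {0..1} (\<lambda>t. (pt t)\<^sup>2) \<le> 64 * m"
      using that(2) by simp
    moreover have "integral {0..1} (\<lambda>t. 1 / 2 + 1 / 2 * (pt t)\<^sup>2) = 1 / 2 + 1 / 2 * integral {0..1} (\<lambda>t. (pt t)\<^sup>2)"
      by (subst integral_add) (auto intro!: integrable_continuous_interval continuous_intros pt_cont)
    ultimately have total: "integral {0..1} (\<lambda>t. 1 / 2 + 1 / 2 * (pt t)\<^sup>2) \<le> B"
      by (simp add: B_def)
    have osc: "\<bar>(P s y)\<^sup>2 - (P s x)\<^sup>2\<bar> \<le> B" if "0 \<le> x" "x \<le> y" "y \<le> 1" for x y
    proof -
      have "(pt has_integral (P s y)\<^sup>2 - (P s x)\<^sup>2) {x..y}"
        using p_t \<open>x \<le> y\<close>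
        by (intro fundamental_theorem_of_calculus)
           (auto simp: has_real_derivative_iff_has_vector_derivative[symmetric] intro: has_field_derivative_at_within)
      then have "\<bar>(P s y)\<^sup>2 - (P s x)\<^sup>2\<bar> = norm (integral {x..y} pt)"
        by (simp add: integral_unique)
      also have "\<dots> \<le> integral {x..y} (\<lambda>t. 1 / 2 + 1 / 2 * (pt t)\<^sup>2)"
      proof (rule integral_norm_bound_integral)
        show "norm (pt t) \<le> 1 / 2 + 1 / 2 * (pt t)\<^sup>2" for t
          using sum_squares_ge_zero[of "\<bar>pt t\<bar> - 1" 0] by (simp add: power2_eq_square algebra_simps)
      qed (auto intro!: integrable_continuous_interval continuous_intros pt_cont)
      also have "\<dots> \<le> integral {0..1} (\<lambda>t. 1 / 2 + 1 / 2 * (pt t)\<^sup>2)"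
        by (intro integral_subset_le integrable_continuous_interval continuous_intros pt_cont)
           (use that in auto)
      finally show ?thesis using total by linarith
    qed
    \<comment> \<open>Every slice contains a zero of \<open>k\<close>, hence of \<open>P\<close>, so
      the oscillation bound is a bound on \<open>P ^ 2\<close> itself.\<close>
    obtain t' where t': "t' \<in> {0..1}" "k s t' = 0" using k_zero[of s] by blast
    have "\<bar>(P s (frac t))\<^sup>2 - (P s t')\<^sup>2\<bar> \<le> B"
      using osc[of "frac t" t'] osc[of t' "frac t"] t'(1) frac_ge_0[of t] frac_lt_1[of t]
      by (cases "frac t \<le> t'") (auto simp: abs_minus_commute)
    then show ?thesis using P_zero[OF that(1) t'(2)] by (simp add: P_frac)
  qed
  \<comment> \<open>A second difference of \<open>I\<close> with step \<open>1 / 2\<close> is at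
    most \<open>24 * m + 24 * m\<close> and equals a quarter of \<open>I''\<close> at an
    intermediate point, whence \<open>192 * m\<close>. The two choices of \<open>c\<close> give one
    slice on either side of \<open>s\<^sub>0\<close>, each at distance less than one.\<close>
  have slices: "\<exists>s>c. s < c + 1 \<and> I'' s \<le> 192 * m" if "c = s\<^sub>0 \<or> c = s\<^sub>0 - 1" for c
  proof -
    have D: "s \<in> D" if "c \<le> s" "s \<le> c + 1" for s using that \<open>c = s\<^sub>0 \<or> c = s\<^sub>0 - 1\<close> by (auto simp: D_def)
    obtain s where s: "c < s" "s < c + 2 * (1 / 2)"
      "I (c + 2 * (1 / 2)) - 2 * I (c + 1 / 2) + I c = (1 / 2)\<^sup>2 * I'' s"
      by (rule second_difference_mvt[of "1 / 2" c I I' I'']) (use I I' D in auto)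
    moreover have "I (c + 1) - 2 * I (c + 1 / 2) + I c \<le> 48 * m"
      using I_nonneg[of "c + 1 / 2"] I_le[of c] I_le[of "c + 1"] D by force
    ultimately show ?thesis by (auto simp: power2_eq_square intro!: exI[of _ s])
  qed
  obtain \<xi>\<^sub>1 where \<xi>\<^sub>1: "s\<^sub>0 - 1 < \<xi>\<^sub>1" "\<xi>\<^sub>1 < s\<^sub>0" "I'' \<xi>\<^sub>1 \<le> 192 * m" using slices[of "s\<^sub>0 - 1"] by auto
  obtain \<xi>\<^sub>2 where \<xi>\<^sub>2: "s\<^sub>0 < \<xi>\<^sub>2" "\<xi>\<^sub>2 < s\<^sub>0 + 1" "I'' \<xi>\<^sub>2 \<le> 192 * m" using slices[of s\<^sub>0] by auto
  have w_bd: "w \<xi>\<^sub>1 t \<le> B\<^sup>2" "w \<xi>\<^sub>2 t \<le> B\<^sup>2" for t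
    using power_mono[OF P_bound[of \<xi>\<^sub>1 t], of 2] power_mono[OF P_bound[of \<xi>\<^sub>2 t], of 2] \<xi>\<^sub>1 \<xi>\<^sub>2
    by (auto simp: w_def D_def power_mult[symmetric])

  \<comment> \<open>Maximum principle between the two slices\<close>
  have "w s\<^sub>0 t\<^sub>0 \<le> B\<^sup>2"
  proof (rule ccontr)
    assume "\<not> w s\<^sub>0 t\<^sub>0 \<le> B\<^sup>2"
    \<comment> \<open>Half of the excess. The term \<open>e * (s - s\<^sub>0)\<^sup>2\<close> makes
      the subharmonicity strict, and being at most \<open>e\<close> on the two end slices it keeps
      the maximum of \<open>z\<close> away from them.\<close>
    define e where "e = (w s\<^sub>0 t\<^sub>0 - B\<^sup>2) / 2"
    have "e > 0" using \<open>\<not> w s\<^sub>0 t\<^sub>0 \<le> B\<^sup>2\<close> by (simp add: e_def)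
    define z where "z s t = w s t + e * (s - s\<^sub>0)\<^sup>2" for s t
    have sub: "{\<xi>\<^sub>1..\<xi>\<^sub>2} \<subseteq> D" using \<xi>\<^sub>1 \<xi>\<^sub>2 by (auto simp: D_def)
    have z_cont: "continuous_on ({\<xi>\<^sub>1..\<xi>\<^sub>2} \<times> {0..1}) (\<lambda>x. z (fst x) (snd x))"
      unfolding z_def
      by (intro continuous_intros continuous_on_subset[OF w_cont]) (use sub in auto)
    have "{\<xi>\<^sub>1..\<xi>\<^sub>2} \<times> {0..1::real} \<noteq> {}" using \<xi>\<^sub>1 \<xi>\<^sub>2 by auto
    from continuous_attains_sup[OF compact_Times[OF compact_Icc compact_Icc] this z_cont]
    obtain x where x: "x \<in> {\<xi>\<^sub>1..\<xi>\<^sub>2} \<times> {0..1}"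
      "\<forall>y\<in>{\<xi>\<^sub>1..\<xi>\<^sub>2} \<times> {0..1}. z (fst y) (snd y) \<le> z (fst x) (snd x)"
      by (elim bexE)
    obtain s1 t1 where st: "x = (s1, t1)" by force
    have z_frac: "z s (frac t) = z s t" for s t
      by (simp add: z_def w_def P_frac)
    \<comment> \<open>Periodicity extends the comparison to all real \<open>t\<close>, so it does no
      harm if \<open>t1\<close> is an end point of \<open>{0..1}\<close>.\<close>
    have max: "z s t \<le> z s1 t1" if "s \<in> {\<xi>\<^sub>1..\<xi>\<^sub>2}" for s t
      using bspec[OF x(2), of "(s, frac t)"] that frac_lt_1[of t] frac_ge_0[of t] z_frac[of s t] by (simp add: st)
    have "z s\<^sub>0 t\<^sub>0 > B\<^sup>2 + e" using \<open>e > 0\<close> by (simp add: z_def e_def field_simps)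
    have ends: "s1 \<noteq> \<xi>" if "\<xi> \<in> {\<xi>\<^sub>1, \<xi>\<^sub>2}" for \<xi>
    proof
      assume "s1 = \<xi>"
      have "(\<xi> - s\<^sub>0)\<^sup>2 \<le> 1\<^sup>2" using that \<xi>\<^sub>1 \<xi>\<^sub>2 by (intro power2_le_iff_abs_le[THEN iffD2]) auto
      then have "e * (\<xi> - s\<^sub>0)\<^sup>2 \<le> e" using \<open>e > 0\<close> by simp
      then have "z s1 t1 \<le> B\<^sup>2 + e"
        using w_bd[of t1] that \<open>s1 = \<xi>\<close> by (auto simp: z_def)
      with max[of s\<^sub>0 t\<^sub>0] \<open>z s\<^sub>0 t\<^sub>0 > B\<^sup>2 + e\<close> \<xi>\<^sub>1 \<xi>\<^sub>2 show False by auto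
    qed
    have s1: "\<xi>\<^sub>1 < s1" "s1 < \<xi>\<^sub>2" using x(1) st ends[of \<xi>\<^sub>1] ends[of \<xi>\<^sub>2] by auto
    then have "s1 \<in> D" using sub by auto
    define d where "d = min (s1 - \<xi>\<^sub>1) (\<xi>\<^sub>2 - s1)"
    have d: "d > 0" "\<And>s. \<bar>s - s1\<bar> < d \<Longrightarrow> s \<in> {\<xi>\<^sub>1..\<xi>\<^sub>2}" using s1 by (auto simp: d_def)
    have "wss s1 t1 + 2 * e \<le> 0"
    proof (rule second_derivative_nonpos_at_max[OF \<open>d > 0\<close>])
      show "((\<lambda>s. z s t1) has_real_derivative ws s t1 + 2 * e * (s - s\<^sub>0)) (at s)" if "\<bar>s - s1\<bar> < d" for s
        unfolding z_def using w_s[of s t1] d(2)[OF that] sub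
        by (auto intro!: derivative_eq_intros)
      show "((\<lambda>s. ws s t1 + 2 * e * (s - s\<^sub>0)) has_real_derivative wss s1 t1 + 2 * e) (at s1)"
        using w_ss[OF \<open>s1 \<in> D\<close>, of t1] by (auto intro!: derivative_eq_intros)
    qed (use d max in auto)
    moreover have "wtt s1 t1 \<le> 0"
    proof (rule second_derivative_nonpos_at_max[OF zero_less_one])
      show "((\<lambda>t. z s1 t) has_real_derivative wt s1 t) (at t)" for t
        unfolding z_def using w_t[OF \<open>s1 \<in> D\<close>, of t] by (auto intro!: derivative_eq_intros)
      show "((\<lambda>t. wt s1 t) has_real_derivative wtt s1 t1) (at t1)" by (rule w_tt[OF \<open>s1 \<in> D\<close>])
    qed (use s1 max in auto)
    moreover have "0 \<le> 12 * (P s1 t1 ^ 2 * (b s1 t1)\<^sup>2)" by simp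
    ultimately show False using lap[OF \<open>s1 \<in> D\<close>, of t1] \<open>e > 0\<close> by linarith
  qed
  then have "(P s\<^sub>0 t\<^sub>0)\<^sup>2 \<le> B"
    using power2_le_imp_le[of "(P s\<^sub>0 t\<^sub>0)\<^sup>2" B] \<open>m \<ge> 0\<close> by (simp add: w_def B_def power_mult[symmetric])
  \<comment> \<open>This avoids a square root. Together with the threshold \<open>2 * C + 1\<close>
    the bound \<open>B + 1\<close> gives \<open>2 * C + 5 / 2 + 32 * m\<close>, rounded up in the
    claim.\<close>
  moreover have "P s\<^sub>0 t\<^sub>0 \<le> (P s\<^sub>0 t\<^sub>0)\<^sup>2 + 1"
    using sum_squares_ge_zero[of "P s\<^sub>0 t\<^sub>0 - 1 / 2" 0] by (simp add: power2_eq_square algebra_simps)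
  ultimately have "P s\<^sub>0 t\<^sub>0 \<le> B + 1" by linarith
  then show ?thesis using \<open>F s\<^sub>0 = 0\<close> by (auto simp: P_def B_def)
qed

section \<open>Continuously differentiable maps\<close>

text \<open>\<open>frechet_derivative\<close> is a choice; by uniqueness of derivatives any
  explicitly computed derivative may stand for it.\<close>

lemma C1_onI:
  assumes "\<And>x. x \<in> S \<Longrightarrow> (f has_derivative f' x) (at x)" "\<And>v. continuous_on S (\<lambda>x. f' x v)"
  shows "Ck_on (Suc 0) S f"
proof -
  have "frechet_derivative f (at x) = f' x" if "x \<in> S" for x
    using frechet_derivative_at[OF assms(1)[OF that]] by simp
  then show ?thesis
    using assms(2) by (auto intro: differentiableI assms(1) cong: continuous_on_cong)
qed

lemma C1_on_has_derivative:
  "Ck_on (Suc k) S f \<Longrightarrow> x \<in> S \<Longrightarrow> (f has_derivative frechet_derivative f (at x)) (at x)"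
  by (auto simp: frechet_derivative_works[symmetric])

lemma C1_on_continuous_derivative:
  "Ck_on (Suc 0) S f \<Longrightarrow> continuous_on S (\<lambda>x. frechet_derivative f (at x) v)"
  by simp

lemma Ck_on_subset: "Ck_on k S f \<Longrightarrow> T \<subseteq> S \<Longrightarrow> Ck_on k T f"
  by (induction k arbitrary: f) (auto intro: continuous_on_subset)

lemma C1_on_imp_continuous_on: "Ck_on (Suc 0) S f \<Longrightarrow> continuous_on S f"
  by (auto intro!: continuous_at_imp_continuous_on differentiable_imp_continuous_within)

lemma C1_on_cong:
  assumes "open S" "Ck_on (Suc 0) S f" "\<And>x. x \<in> S \<Longrightarrow> f x = g x"
  shows "Ck_on (Suc 0) S g"
proof (rule C1_onI)
  show "(g has_derivative frechet_derivative f (at x)) (at x)" if "x \<in> S" for x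
    using C1_on_has_derivative[OF assms(2) that]
    by (rule has_derivative_transform_within_open[OF _ assms(1) that assms(3)])
qed (use assms(2) in simp)

lemma C1_on_local:
  assumes "\<And>x. x \<in> S \<Longrightarrow> \<exists>T. open T \<and> x \<in> T \<and> Ck_on (Suc 0) T f"
  shows "Ck_on (Suc 0) S f"
proof (rule C1_onI)
  fix x assume "x \<in> S"
  then show "(f has_derivative frechet_derivative f (at x)) (at x)"
    using assms C1_on_has_derivative by blast
next
  show "continuous_on S (\<lambda>x. frechet_derivative f (at x) v)" for v
  proof (intro continuous_at_imp_continuous_on ballI)
    fix x assume "x \<in> S"
    then obtain T where "open T" "x \<in> T" "Ck_on (Suc 0) T f" using assms by blast
    then show "isCont (\<lambda>x. frechet_derivative f (at x) v) x"
      by (simp add: continuous_on_eq_continuous_at)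
  qed
qed

lemma C1_on_mult:
  fixes f g :: "'a::real_normed_vector \<Rightarrow> real"
  assumes "Ck_on (Suc 0) S f" "Ck_on (Suc 0) S g"
  shows "Ck_on (Suc 0) S (\<lambda>x. f x * g x)"
proof (rule C1_onI)
  show "((\<lambda>x. f x * g x) has_derivative
      (\<lambda>v. f x * frechet_derivative g (at x) v + frechet_derivative f (at x) v * g x)) (at x)"
    if "x \<in> S" for x
    by (intro has_derivative_mult C1_on_has_derivative[OF assms(1) that] C1_on_has_derivative[OF assms(2) that])
qed (use assms C1_on_imp_continuous_on[OF assms(1)] C1_on_imp_continuous_on[OF assms(2)] in
      \<open>auto intro!: continuous_intros\<close>)

lemma C1_on_sum:
  assumes "\<And>i. i \<in> I \<Longrightarrow> Ck_on (Suc 0) S (f i)"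
  shows "Ck_on (Suc 0) S (\<lambda>x. \<Sum>i\<in>I. f i x)"
proof (rule C1_onI)
  show "((\<lambda>x. \<Sum>i\<in>I. f i x) has_derivative (\<lambda>v. \<Sum>i\<in>I. frechet_derivative (f i) (at x) v)) (at x)"
    if "x \<in> S" for x
    by (intro has_derivative_sum C1_on_has_derivative[OF assms that])
qed (use assms in \<open>auto intro!: continuous_intros\<close>)

lemma C1_on_inner:
  assumes "Ck_on (Suc 0) S f"
  shows "Ck_on (Suc 0) S (\<lambda>x. f x \<bullet> i)"
proof (rule C1_onI)
  show "((\<lambda>x. f x \<bullet> i) has_derivative (\<lambda>v. frechet_derivative f (at x) v \<bullet> i)) (at x)"
    if "x \<in> S" for x
    by (intro has_derivative_inner_left C1_on_has_derivative[OF assms that])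
qed (use assms in \<open>auto intro!: continuous_intros\<close>)

lemma linear_euclidean_expand:
  fixes L :: "'a::euclidean_space \<Rightarrow> 'b::real_vector"
  assumes "linear L"
  shows "L v = (\<Sum>i\<in>Basis. (v \<bullet> i) *\<^sub>R L i)"
  by (subst euclidean_representation[of v, symmetric])
     (simp add: linear_sum[OF assms] linear_cmul[OF assms] del: euclidean_representation)

text \<open>\<open>Ck_on\<close> gives continuity of the derivative in fixed directions only,
  whereas the derivative of \<open>f\<close> feeds a varying direction into that of
  \<open>g\<close>. Expanding this direction in a basis resolves the mismatch, which is why the
  intermediate space is Euclidean.\<close>

lemma C1_on_compose:
  fixes f :: "'a::real_normed_vector \<Rightarrow> 'b::euclidean_space"
  assumes "Ck_on (Suc 0) S f" "Ck_on (Suc 0) T g" "f ` S \<subseteq> T"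
  shows "Ck_on (Suc 0) S (g \<circ> f)"
proof (rule C1_onI)
  show "(g \<circ> f has_derivative frechet_derivative g (at (f x)) \<circ> frechet_derivative f (at x)) (at x)"
    if "x \<in> S" for x
    by (intro diff_chain_at C1_on_has_derivative[OF assms(1) that] C1_on_has_derivative[OF assms(2)])
       (use that assms(3) in blast)
next
  fix v
  have "continuous_on S (\<lambda>x. frechet_derivative f (at x) v)" using assms(1) by simp
  moreover have "continuous_on S (\<lambda>x. frechet_derivative g (at (f x)) i)" for i
    by (rule continuous_on_compose2[OF _ C1_on_imp_continuous_on[OF assms(1)] assms(3)])
       (use assms(2) in simp)
  ultimately have "continuous_on S (\<lambda>x. \<Sum>i\<in>Basis. (frechet_derivative f (at x) v \<bullet> i) *\<^sub>R frechet_derivative g (at (f x)) i)"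
    by (intro continuous_on_sum continuous_on_scaleR continuous_on_inner continuous_on_const)
  moreover have "(\<Sum>i\<in>Basis. (frechet_derivative f (at x) v \<bullet> i) *\<^sub>R frechet_derivative g (at (f x)) i) =
      (frechet_derivative g (at (f x)) \<circ> frechet_derivative f (at x)) v" if "x \<in> S" for x
  proof -
    have "f x \<in> T" using that assms(3) by blast
    then have "linear (frechet_derivative g (at (f x)))"
      using has_derivative_linear[OF C1_on_has_derivative[OF assms(2)]] by blast
    from linear_euclidean_expand[OF this] show ?thesis unfolding comp_apply by (rule sym)
  qed
  ultimately show "continuous_on S (\<lambda>x. (frechet_derivative g (at (f x)) \<circ> frechet_derivative f (at x)) v)"
    by (rule continuous_on_eq)
qed

lemma smooth_on_C1: "smooth_on S f \<Longrightarrow> Ck_on (Suc 0) S f"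
  by (simp only: smooth_on_def)

lemma smooth_on_C1_derivative:
  assumes "smooth_on S f" shows "Ck_on (Suc 0) S (\<lambda>x. frechet_derivative f (at x) v)"
proof -
  have "Ck_on (Suc (Suc 0)) S f" using assms by (simp only: smooth_on_def)
  then show ?thesis by (simp only: Ck_on.simps(2)[of "Suc 0"])
qed

lemma has_derivative_partials:
  fixes f :: "real \<times> real \<Rightarrow> 'b::real_normed_vector"
  assumes "(f has_derivative f') (at (s, t))"
  shows "((\<lambda>\<sigma>. f (\<sigma>, t)) has_vector_derivative f' (1, 0)) (at s)"
    and "((\<lambda>\<tau>. f (s, \<tau>)) has_vector_derivative f' (0, 1)) (at t)"
proof -
  have lin: "linear f'" using assms by (rule has_derivative_linear)
  have "((\<lambda>\<sigma>. (\<sigma>, t)) has_derivative (\<lambda>h. (h, 0))) (at s)"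
    "((\<lambda>\<tau>. (s, \<tau>)) has_derivative (\<lambda>h. (0, h))) (at t)"
    by (intro has_derivative_Pair has_derivative_ident has_derivative_const)+
  from has_derivative_compose[OF this(1) assms] has_derivative_compose[OF this(2) assms]
  have "((\<lambda>\<sigma>. f (\<sigma>, t)) has_derivative (\<lambda>h. f' (h, 0))) (at s)"
    "((\<lambda>\<tau>. f (s, \<tau>)) has_derivative (\<lambda>h. f' (0, h))) (at t)" .
  moreover have "(\<lambda>h. f' (h, 0)) = (\<lambda>h. h *\<^sub>R f' (1, 0))" "(\<lambda>h. f' (0, h)) = (\<lambda>h. h *\<^sub>R f' (0, 1))"
  proof -
    show "(\<lambda>h. f' (h, 0)) = (\<lambda>h. h *\<^sub>R f' (1, 0))"
    proof
      show "f' (h, 0) = h *\<^sub>R f' (1, 0)" for h using linear_cmul[OF lin, of h "(1, 0)"] by simp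
    qed
    show "(\<lambda>h. f' (0, h)) = (\<lambda>h. h *\<^sub>R f' (0, 1))"
    proof
      show "f' (0, h) = h *\<^sub>R f' (0, 1)" for h using linear_cmul[OF lin, of h "(0, 1)"] by simp
    qed
  qed
  ultimately show "((\<lambda>\<sigma>. f (\<sigma>, t)) has_vector_derivative f' (1, 0)) (at s)"
    "((\<lambda>\<tau>. f (s, \<tau>)) has_vector_derivative f' (0, 1)) (at t)"
    by (simp_all only: has_vector_derivative_def)
qed

text \<open>Schwarz's theorem for each coordinate, on a square of half-width \<open>e / 2\<close>,
  which lies in the ball of radius \<open>e\<close> about the point.\<close>

lemma second_derivative_symmetric:
  fixes f :: "real \<times> real \<Rightarrow> 'b::euclidean_space"
  assumes "open S" "smooth_on S f" "x \<in> S"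
  shows "frechet_derivative (\<lambda>x. frechet_derivative f (at x) (1, 0)) (at x) (0, 1) =
         frechet_derivative (\<lambda>x. frechet_derivative f (at x) (0, 1)) (at x) (1, 0)"
proof (rule euclidean_eqI)
  fix i :: 'b assume "i \<in> Basis"
  obtain a b where x: "x = (a, b)" by force
  obtain e where e: "e > 0" "ball x e \<subseteq> S" using assms openE by blast
  have box: "(s, t) \<in> S" if "\<bar>s - a\<bar> < e / 2" "\<bar>t - b\<bar> < e / 2" for s t
  proof -
    have "dist (s, t) (a, b) \<le> dist s a + dist t b"
      unfolding dist_Pair_Pair by (rule sqrt_sum_squares_le_sum) auto
    then have "dist (a, b) (s, t) < e"
      using that unfolding dist_real_def dist_commute[of "(s, t)"] by linarith
    with e(2) show ?thesis by (auto simp: x)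
  qed
  define D where "D f v x = frechet_derivative f (at x) v" for f :: "real \<times> real \<Rightarrow> 'b" and v x
  note C1 = smooth_on_C1[OF assms(2)] smooth_on_C1_derivative[OF assms(2)]
  have partials: "((\<lambda>s. g (s, t) \<bullet> i) has_real_derivative D g (1, 0) (s, t) \<bullet> i) (at s)"
    "((\<lambda>t. g (s, t) \<bullet> i) has_real_derivative D g (0, 1) (s, t) \<bullet> i) (at t)"
    if "\<bar>s - a\<bar> < e / 2" "\<bar>t - b\<bar> < e / 2" "Ck_on (Suc 0) S g" for s t g
  proof -
    note * = C1_on_has_derivative[OF that(3) box[OF that(1,2)]]
    show "((\<lambda>s. g (s, t) \<bullet> i) has_real_derivative D g (1, 0) (s, t) \<bullet> i) (at s)"
      "((\<lambda>t. g (s, t) \<bullet> i) has_real_derivative D g (0, 1) (s, t) \<bullet> i) (at t)"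
      using bounded_linear.has_vector_derivative[OF bounded_linear_inner_left has_derivative_partials(1)[OF *]]
        bounded_linear.has_vector_derivative[OF bounded_linear_inner_left has_derivative_partials(2)[OF *]]
      by (simp_all add: has_real_derivative_iff_has_vector_derivative D_def)
  qed
  have C1D: "Ck_on (Suc 0) S (D f v)" for v
    unfolding D_def[abs_def] by (rule C1(2))
  note 1 = partials(1)[OF _ _ C1(1)] partials(2)[OF _ _ C1(1)] partials(1)[OF _ _ C1D] partials(2)[OF _ _ C1D]
  have 2: "isCont (\<lambda>(s, t). D (D f v) w (s, t) \<bullet> i) (a, b)" for v w
  proof -
    have "continuous_on S (\<lambda>x. D (D f v) w x \<bullet> i)"
      unfolding D_def[of "D f v"]
      by (intro continuous_on_inner continuous_on_const C1_on_continuous_derivative C1D)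
    then show ?thesis
      using assms x by (simp add: continuous_on_eq_continuous_at case_prod_beta')
  qed
  show "frechet_derivative (\<lambda>x. frechet_derivative f (at x) (1, 0)) (at x) (0, 1) \<bullet> i =
         frechet_derivative (\<lambda>x. frechet_derivative f (at x) (0, 1)) (at x) (1, 0) \<bullet> i"
    using mixed_partials_eq[of "e / 2" a b "\<lambda>s t. f (s, t) \<bullet> i", OF _ 1(1,2,4,3) 2 2] e(1)
    by (simp add: x D_def[abs_def])
qed

declare Ck_on.simps [simp del]

section \<open>Differentials and exterior derivatives in charts\<close>

locale smooth_manifold =
  fixes A :: "('m::{t2_space,second_countable_topology}, 'e::euclidean_space) chart set"
  assumes atlas: "smooth_atlas A"
begin

lemma
  assumes "c \<in> A"
  shows open_cdom: "open (cdom c)"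
    and open_cimage: "open (cmap c ` cdom c)"
    and chart_homeomorphism: "homeomorphism (cdom c) (cmap c ` cdom c) (cmap c) (cinv c)"
  using atlas assms by (auto simp: smooth_atlas_def)

lemma
  assumes "c \<in> A"
  shows cinv_cmap: "p \<in> cdom c \<Longrightarrow> cinv c (cmap c p) = p"
    and cinv_in: "x \<in> cmap c ` cdom c \<Longrightarrow> cinv c x \<in> cdom c"
  using chart_homeomorphism[OF assms] by (auto simp: homeomorphism_def)

lemma chart_at_in: "chart_at A p \<in> A" and in_chart_at: "p \<in> cdom (chart_at A p)"
proof -
  have "p \<in> (\<Union>c\<in>A. cdom c)" using atlas by (simp add: smooth_atlas_def)
  then have "\<exists>c. c \<in> A \<and> p \<in> cdom c" by blast
  from someI_ex[OF this] show "chart_at A p \<in> A" "p \<in> cdom (chart_at A p)"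
    by (auto simp: chart_at_def)
qed

lemma open_cimage_Int:
  assumes "c \<in> A" "open V"
  shows "open (cmap c ` (cdom c \<inter> V))"
proof -
  have "openin (top_of_set (cmap c ` cdom c)) (cmap c ` (cdom c \<inter> V))"
    by (rule homeomorphism_imp_open_map[OF chart_homeomorphism[OF assms(1)]])
       (use assms(2) in \<open>auto simp: openin_open\<close>)
  then show ?thesis using open_cimage[OF assms(1)] by (rule openin_open_trans)
qed

lemma transition_C1:
  assumes "c \<in> A" "d \<in> A"
  shows "Ck_on (Suc 0) (cmap c ` (cdom c \<inter> cdom d)) (cmap d \<circ> cinv c)"
  using atlas assms by (intro smooth_on_C1) (simp add: smooth_atlas_def)

lemma transition_has_derivative:
  assumes "c \<in> A" "d \<in> A" "p \<in> cdom c" "p \<in> cdom d"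
  shows "(cmap d \<circ> cinv c has_derivative frechet_derivative (cmap d \<circ> cinv c) (at (cmap c p))) (at (cmap c p))"
  by (rule C1_on_has_derivative[OF transition_C1[OF assms(1,2)]]) (use assms(3,4) in auto)

lemma linear_from_coord:
  assumes "c \<in> A" "p \<in> cdom c"
  shows "linear (from_coord A c p)"
  unfolding from_coord_def[abs_def]
  by (rule has_derivative_linear[OF transition_has_derivative[OF assms(1) chart_at_in assms(2) in_chart_at]])

text \<open>Chain rule for a composite that is the identity near \<open>cmap c p\<close>.\<close>

lemma transition_inverse:
  assumes "c \<in> A" "d \<in> A" "p \<in> cdom c" "p \<in> cdom d"
  shows "frechet_derivative (cmap c \<circ> cinv d) (at (cmap d p))
           (frechet_derivative (cmap d \<circ> cinv c) (at (cmap c p)) v) = v"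
proof -
  have "(cmap c \<circ> cinv d has_derivative frechet_derivative (cmap c \<circ> cinv d) (at (cmap d p)))
     (at ((cmap d \<circ> cinv c) (cmap c p)))"
    using transition_has_derivative[OF assms(2,1,4,3)] assms by (simp add: cinv_cmap)
  from diff_chain_at[OF transition_has_derivative[OF assms] this]
  have "((cmap c \<circ> cinv d) \<circ> (cmap d \<circ> cinv c) has_derivative
     (frechet_derivative (cmap c \<circ> cinv d) (at (cmap d p)) \<circ>
      frechet_derivative (cmap d \<circ> cinv c) (at (cmap c p)))) (at (cmap c p))" .
  then have "((\<lambda>x. x) has_derivative
     (frechet_derivative (cmap c \<circ> cinv d) (at (cmap d p)) \<circ>
      frechet_derivative (cmap d \<circ> cinv c) (at (cmap c p)))) (at (cmap c p))"
    by (rule has_derivative_transform_within_open[where s = "cmap c ` (cdom c \<inter> cdom d)"])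
       (use assms open_cdom in \<open>auto simp: open_cimage_Int cinv_cmap\<close>)
  from has_derivative_unique[OF this has_derivative_ident] show ?thesis
    by (simp add: fun_eq_iff)
qed

lemma from_coord_to_coord:
  assumes "c \<in> A" "p \<in> cdom c"
  shows "from_coord A c p (to_coord A c p v) = v"
  unfolding from_coord_def to_coord_def
  by (rule transition_inverse[OF chart_at_in assms(1) in_chart_at assms(2)])

text \<open>The differential of a map into the manifold, its values being represented in the
  preferred chart like all tangent vectors. That chart may jump with \<open>x\<close>, so
  \<open>push f x v\<close> need not be continuous in \<open>x\<close>.\<close>

definition push :: "('a::real_normed_vector \<Rightarrow> 'm) \<Rightarrow> 'a \<Rightarrow> 'a \<Rightarrow> 'e" where
  "push f x v = frechet_derivative (cmap (chart_at A (f x)) \<circ> f) (at x) v"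

lemma open_chart_preimage:
  assumes "smooth_into A S f" "open S" "open V"
  shows "open {x \<in> S. f x \<in> V}"
proof -
  have "continuous_on S f" using assms(1) by (simp add: smooth_into_def)
  from continuous_open_preimage[OF this assms(2,3)] show ?thesis
    by (simp add: vimage_def Int_def)
qed

lemma smooth_into_chart:
  assumes "smooth_into A S f" "c \<in> A"
  shows "smooth_on {x \<in> S. f x \<in> cdom c} (cmap c \<circ> f)"
  using assms by (auto simp: smooth_into_def)

lemma chart_has_derivative:
  assumes "smooth_into A S f" "c \<in> A" "x \<in> S" "f x \<in> cdom c"
  shows "(cmap c \<circ> f has_derivative frechet_derivative (cmap c \<circ> f) (at x)) (at x)"
  by (rule C1_on_has_derivative[OF smooth_on_C1[OF smooth_into_chart[OF assms(1,2)]]]) (use assms in auto)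

lemma push_has_derivative:
  assumes "smooth_into A S f" "x \<in> S"
  shows "(cmap (chart_at A (f x)) \<circ> f has_derivative push f x) (at x)"
  unfolding push_def[abs_def] by (rule chart_has_derivative[OF assms(1) chart_at_in assms(2) in_chart_at])

text \<open>Chain rule through the change of charts. With \<open>c\<close> fixed, the dependence on
  \<open>x\<close> can be studied in spite of the varying preferred chart.\<close>

lemma push_in_chart:
  assumes f: "smooth_into A S f" "open S" "x \<in> S" and c: "c \<in> A" "f x \<in> cdom c"
  shows "push f x v = from_coord A c (f x) (frechet_derivative (cmap c \<circ> f) (at x) v)"
proof -
  let ?c' = "chart_at A (f x)"
  have "(cmap ?c' \<circ> cinv c has_derivative from_coord A c (f x)) (at ((cmap c \<circ> f) x))"
    unfolding from_coord_def[abs_def] comp_apply[of "cmap c"]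
    by (rule transition_has_derivative[OF c(1) chart_at_in c(2) in_chart_at])
  from diff_chain_at[OF chart_has_derivative[OF f(1) c(1) f(3) c(2)] this]
  have "((cmap ?c' \<circ> cinv c) \<circ> (cmap c \<circ> f) has_derivative
      from_coord A c (f x) \<circ> frechet_derivative (cmap c \<circ> f) (at x)) (at x)" .
  then have "(cmap ?c' \<circ> f has_derivative
      from_coord A c (f x) \<circ> frechet_derivative (cmap c \<circ> f) (at x)) (at x)"
    by (rule has_derivative_transform_within_open[where s = "{x \<in> S. f x \<in> cdom c}"])
       (use f c open_chart_preimage[OF f(1,2) open_cdom[OF c(1)]] in \<open>auto simp: cinv_cmap\<close>)
  from has_derivative_unique[OF push_has_derivative[OF f(1,3)] this] show ?thesis
    by (simp add: fun_eq_iff)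
qed

text \<open>Chain rule. Along horizontal and vertical lines it identifies the velocities in the flow
  equation with partial derivatives of \<open>u\<close> as a map on the plane.\<close>

lemma velocity_eq_push:
  assumes "smooth_into A S f" "\<gamma> t \<in> S" "(\<gamma> has_vector_derivative v) (at t)"
  shows "velocity A (\<lambda>\<tau>. f (\<gamma> \<tau>)) t = push f (\<gamma> t) v"
proof -
  have d: "(\<gamma> has_derivative (\<lambda>h. h *\<^sub>R v)) (at t)"
    using assms(3) by (simp add: has_vector_derivative_def)
  note p = push_has_derivative[OF assms(1,2)]
  have "linear (push f (\<gamma> t))" using p by (rule has_derivative_linear)
  with has_derivative_compose[OF d p]
  have "((\<lambda>\<tau>. cmap (chart_at A (f (\<gamma> t))) (f (\<gamma> \<tau>))) has_vector_derivative push f (\<gamma> t) v) (at t)"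
    by (simp add: has_vector_derivative_def linear_cmul)
  then show ?thesis unfolding velocity_def by (rule vector_derivative_at)
qed

lemma smooth_fun_C1:
  assumes "smooth_fun A N g" "c \<in> A"
  shows "Ck_on (Suc 0) (cmap c ` (cdom c \<inter> N)) (g \<circ> cinv c)"
  using assms by (intro smooth_on_C1) (simp add: smooth_fun_def)

lemma diff_fun_has_derivative:
  assumes "smooth_fun A N g" "p \<in> N"
  shows "(g \<circ> cinv (chart_at A p) has_derivative diff_fun A g p) (at (cmap (chart_at A p) p))"
  unfolding diff_fun_def[abs_def]
  by (rule C1_on_has_derivative[OF smooth_fun_C1[OF assms(1) chart_at_in]]) (use assms(2) in_chart_at in auto)

lemma linear_diff_fun:
  assumes "smooth_fun A N g" "p \<in> N"
  shows "linear (diff_fun A g p)"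
  by (rule has_derivative_linear[OF diff_fun_has_derivative[OF assms]])

lemma smooth_fun_isCont:
  assumes "smooth_fun A N g" "open N" "p \<in> N"
  shows "isCont g p"
proof -
  let ?c = "chart_at A p"
  have "isCont (g \<circ> cinv ?c) (cmap ?c p)"
    using diff_fun_has_derivative[OF assms(1,3)] by (rule has_derivative_continuous)
  moreover have "isCont (cmap ?c) p"
    using chart_homeomorphism[OF chart_at_in, of p] open_cdom[OF chart_at_in] in_chart_at
    by (auto simp: homeomorphism_def continuous_on_eq_continuous_at)
  ultimately have "isCont ((g \<circ> cinv ?c) \<circ> cmap ?c) p" by (rule continuous_at_compose[rotated])
  moreover have "\<forall>\<^sub>F q in nhds p. ((g \<circ> cinv ?c) \<circ> cmap ?c) q = g q"
    using in_chart_at[of p] open_cdom[OF chart_at_in, of p]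
    by (auto simp: eventually_nhds cinv_cmap[OF chart_at_in])
  ultimately show ?thesis by (simp add: isCont_cong)
qed

lemma fun_push_has_derivative:
  assumes "smooth_fun A N g" "open N" "smooth_into A S f" "open S" "x \<in> S" "f x \<in> N"
  shows "((\<lambda>x. g (f x)) has_derivative (\<lambda>v. diff_fun A g (f x) (push f x v))) (at x)"
proof -
  let ?c = "chart_at A (f x)"
  have "(g \<circ> cinv ?c has_derivative diff_fun A g (f x)) (at ((cmap ?c \<circ> f) x))"
    using diff_fun_has_derivative[OF assms(1,6)] by simp
  from has_derivative_compose[OF push_has_derivative[OF assms(3,5)] this]
  show ?thesis
    by (rule has_derivative_transform_within_open[where s = "{x \<in> S. f x \<in> cdom ?c}"])
       (use assms open_chart_preimage[OF assms(3,4) open_cdom[OF chart_at_in]] in_chart_at in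
         \<open>auto simp: cinv_cmap[OF chart_at_in]\<close>)
qed

lemma C1_on_fun_compose:
  fixes f :: "'a::real_normed_vector \<Rightarrow> 'm"
  assumes "smooth_fun A N g" "open N" "smooth_into A S f" "open S"
  shows "Ck_on (Suc 0) {x \<in> S. f x \<in> N} (\<lambda>x. g (f x))"
proof (rule C1_on_local)
  fix x assume x: "x \<in> {x \<in> S. f x \<in> N}"
  let ?c = "chart_at A (f x)"
  let ?T = "{x \<in> S. f x \<in> cdom ?c \<inter> N}"
  have "open ?T"
    by (intro open_chart_preimage assms open_Int open_cdom chart_at_in)
  moreover have "Ck_on (Suc 0) ?T ((g \<circ> cinv ?c) \<circ> (cmap ?c \<circ> f))"
    by (rule C1_on_compose[OF Ck_on_subset[OF smooth_on_C1[OF smooth_into_chart[OF assms(3) chart_at_in]]]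
          smooth_fun_C1[OF assms(1) chart_at_in]]) auto
  ultimately have "Ck_on (Suc 0) ?T (\<lambda>x. g (f x))"
    by (rule C1_on_cong) (auto simp: cinv_cmap[OF chart_at_in])
  with \<open>open ?T\<close> x in_chart_at show "\<exists>T. open T \<and> x \<in> T \<and> Ck_on (Suc 0) T (\<lambda>x. g (f x))"
    by (intro exI[of _ ?T]) auto
qed

text \<open>Regularity is asked for in fixed directions; together with linearity this covers all
  components. One derivative is what the exterior derivative takes.\<close>

definition C1_form :: "('m \<Rightarrow> 'e \<Rightarrow> real) \<Rightarrow> bool" where
  "C1_form \<alpha> \<longleftrightarrow> (\<forall>p. linear (\<alpha> p)) \<and>
     (\<forall>c\<in>A. \<forall>v. Ck_on (Suc 0) (cmap c ` cdom c) (\<lambda>x. form1_in A c \<alpha> x v))"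

lemma form1_in_expand:
  assumes "C1_form \<alpha>" "c \<in> A" "x \<in> cmap c ` cdom c"
  shows "form1_in A c \<alpha> x v = (\<Sum>i\<in>Basis. (v \<bullet> i) * form1_in A c \<alpha> x i)"
proof -
  have "linear (\<alpha> (cinv c x) \<circ> from_coord A c (cinv c x))"
    using assms by (intro linear_compose linear_from_coord cinv_in) (auto simp: C1_form_def)
  from linear_euclidean_expand[OF this, of v] show ?thesis by (simp add: form1_in_def)
qed

text \<open>The coordinate formula for a pullback. Its right-hand side involves only the fixed chart
  \<open>c\<close> and can therefore be differentiated in \<open>x\<close>.\<close>

lemma form_push_in_chart:
  assumes "C1_form \<alpha>" "smooth_into A S f" "open S" "c \<in> A" "x \<in> S" "f x \<in> cdom c"
  shows "\<alpha> (f x) (push f x v) =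
    (\<Sum>i\<in>Basis. (frechet_derivative (cmap c \<circ> f) (at x) v \<bullet> i) * form1_in A c \<alpha> (cmap c (f x)) i)"
proof -
  have "\<alpha> (f x) (push f x v) = form1_in A c \<alpha> (cmap c (f x)) (frechet_derivative (cmap c \<circ> f) (at x) v)"
    using assms by (simp add: form1_in_def push_in_chart cinv_cmap)
  then show ?thesis using form1_in_expand[OF assms(1,4)] assms(6) by simp
qed

lemma C1_on_form_push:
  assumes "C1_form \<alpha>" "smooth_into A S f" "open S"
  shows "Ck_on (Suc 0) S (\<lambda>x. \<alpha> (f x) (push f x v))"
proof (rule C1_on_local)
  fix x assume x: "x \<in> S"
  let ?c = "chart_at A (f x)"
  let ?T = "{x \<in> S. f x \<in> cdom ?c}"
  have "open ?T"
    by (intro open_chart_preimage assms open_cdom chart_at_in)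
  moreover note sm = smooth_into_chart[OF assms(2) chart_at_in, of "f x"]
  have "Ck_on (Suc 0) ?T ((\<lambda>x. form1_in A ?c \<alpha> x i) \<circ> (cmap ?c \<circ> f))" for i
    by (rule C1_on_compose[OF smooth_on_C1[OF sm], of "cmap ?c ` cdom ?c"])
       (use assms(1) chart_at_in in \<open>auto simp: C1_form_def\<close>)
  then have "Ck_on (Suc 0) ?T (\<lambda>x. form1_in A ?c \<alpha> (cmap ?c (f x)) i)" for i
    by (simp only: comp_def)
  then have "Ck_on (Suc 0) ?T (\<lambda>x. \<Sum>i\<in>Basis. (frechet_derivative (cmap ?c \<circ> f) (at x) v \<bullet> i) *
      form1_in A ?c \<alpha> (cmap ?c (f x)) i)"
    by (intro C1_on_sum C1_on_mult C1_on_inner smooth_on_C1_derivative[OF sm])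
  ultimately have "Ck_on (Suc 0) ?T (\<lambda>x. \<alpha> (f x) (push f x v))"
    by (rule C1_on_cong) (auto simp: form_push_in_chart[OF assms chart_at_in])
  with \<open>open ?T\<close> x in_chart_at show "\<exists>T. open T \<and> x \<in> T \<and> Ck_on (Suc 0) T (\<lambda>x. \<alpha> (f x) (push f x v))"
    by (intro exI[of _ ?T]) auto
qed

text \<open>Product rule for the coordinate formula. The last summand carries the second derivatives
  of \<open>f\<close> in the chart, which cancel after antisymmetrization.\<close>

lemma form_push_has_derivative:
  assumes "C1_form \<alpha>" "smooth_into A S f" "open S" "c \<in> A" "x \<in> S" "f x \<in> cdom c"
  defines "D \<equiv> \<lambda>v y. frechet_derivative (cmap c \<circ> f) (at y) v"
    and "\<phi> \<equiv> \<lambda>i y. form1_in A c \<alpha> y i"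
  shows "((\<lambda>x. \<alpha> (f x) (push f x v)) has_derivative
    (\<lambda>w. \<Sum>i\<in>Basis. (D v x \<bullet> i) * frechet_derivative (\<phi> i) (at (cmap c (f x))) (D w x)
        + (frechet_derivative (D v) (at x) w \<bullet> i) * \<phi> i (cmap c (f x)))) (at x)"
proof -
  let ?T = "{x \<in> S. f x \<in> cdom c}"
  have T: "open ?T" "x \<in> ?T"
    using assms by (auto intro!: open_chart_preimage open_cdom)
  have "(D v has_derivative frechet_derivative (D v) (at x)) (at x)"
    using C1_on_has_derivative[OF smooth_on_C1_derivative[OF smooth_into_chart[OF assms(2,4)]] T(2)]
    by (simp only: D_def)
  then have 1: "((\<lambda>y. D v y \<bullet> i) has_derivative (\<lambda>w. frechet_derivative (D v) (at x) w \<bullet> i)) (at x)" for i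
    by (rule has_derivative_inner_left)
  have "Ck_on (Suc 0) (cmap c ` cdom c) (\<phi> i)" for i
    using assms(1,4) unfolding C1_form_def \<phi>_def by blast
  then have "(\<phi> i has_derivative frechet_derivative (\<phi> i) (at ((cmap c \<circ> f) x))) (at ((cmap c \<circ> f) x))" for i
    by (rule C1_on_has_derivative) (use assms(6) in auto)
  from has_derivative_compose[OF chart_has_derivative[OF assms(2,4,5,6)] this]
  have 2: "((\<lambda>y. \<phi> i (cmap c (f y))) has_derivative
      (\<lambda>w. frechet_derivative (\<phi> i) (at (cmap c (f x))) (D w x))) (at x)" for i
    by (simp add: D_def)
  have "((\<lambda>y. \<Sum>i\<in>Basis. (D v y \<bullet> i) * \<phi> i (cmap c (f y))) has_derivative
    (\<lambda>w. \<Sum>i\<in>Basis. (D v x \<bullet> i) * frechet_derivative (\<phi> i) (at (cmap c (f x))) (D w x)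
        + (frechet_derivative (D v) (at x) w \<bullet> i) * \<phi> i (cmap c (f x)))) (at x)"
    by (intro has_derivative_sum has_derivative_mult 1 2)
  then show ?thesis
    by (rule has_derivative_transform_within_open[OF _ T])
       (use form_push_in_chart[OF assms(1-4)] in \<open>auto simp: D_def \<phi>_def\<close>)
qed

text \<open>Exterior derivative and pullback commute. On the plane the coordinate fields commute, so
  no bracket term occurs; in the chart the second derivatives of \<open>f\<close> cancel by
  Schwarz's theorem and the derivatives of the components of \<open>\<alpha>\<close> remain.\<close>

lemma ext_deriv1_push:
  fixes f :: "real \<times> real \<Rightarrow> 'm"
  assumes "C1_form \<alpha>" "smooth_into A S f" "open S" "x \<in> S"
  shows "frechet_derivative (\<lambda>x. \<alpha> (f x) (push f x (0, 1))) (at x) (1, 0)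
       - frechet_derivative (\<lambda>x. \<alpha> (f x) (push f x (1, 0))) (at x) (0, 1)
       = ext_deriv1 A \<alpha> (f x) (push f x (1, 0)) (push f x (0, 1))"
proof -
  \<comment> \<open>With this chart \<open>push\<close> at \<open>x\<close> and
    \<open>ext_deriv1\<close> at \<open>f x\<close> refer to the same coordinates.\<close>
  define c where "c = chart_at A (f x)"
  have c: "c \<in> A" "f x \<in> cdom c" by (auto simp: c_def chart_at_in in_chart_at)
  define D where "D v y = frechet_derivative (cmap c \<circ> f) (at y) v" for v y
  define \<phi> where "\<phi> i y = form1_in A c \<alpha> y i" for i y
  define y where "y = cmap c (f x)"
  let ?T = "{x \<in> S. f x \<in> cdom c}"
  have T: "open ?T" "x \<in> ?T"
    using assms c by (auto intro!: open_chart_preimage open_cdom)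
  have symm: "frechet_derivative (D (1, 0)) (at x) (0, 1) = frechet_derivative (D (0, 1)) (at x) (1, 0)"
    using second_derivative_symmetric[OF T(1) smooth_into_chart[OF assms(2) c(1)] T(2)]
    by (simp only: D_def[abs_def])
  have d: "frechet_derivative (\<lambda>x. \<alpha> (f x) (push f x v)) (at x) w =
      (\<Sum>i\<in>Basis. (D v x \<bullet> i) * frechet_derivative (\<phi> i) (at y) (D w x)
        + (frechet_derivative (D v) (at x) w \<bullet> i) * \<phi> i y)" for v w
    using frechet_derivative_at[OF form_push_has_derivative[OF assms(1-3) c(1) assms(4) c(2)], of v]
    unfolding D_def[abs_def] \<phi>_def[abs_def] y_def by (rule fun_cong[OF sym])
  have C1: "Ck_on (Suc 0) (cmap c ` cdom c) (\<phi> i)" for i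
    using assms(1) c(1) unfolding C1_form_def \<phi>_def[abs_def] by blast
  have y: "y \<in> cmap c ` cdom c" using c by (auto simp: y_def)
  have e: "frechet_derivative (\<lambda>z. form1_in A c \<alpha> z v) (at y) w =
      (\<Sum>i\<in>Basis. (v \<bullet> i) * frechet_derivative (\<phi> i) (at y) w)" for v w
  proof -
    have "((\<lambda>z. \<Sum>i\<in>Basis. (v \<bullet> i) * \<phi> i z) has_derivative
       (\<lambda>w. \<Sum>i\<in>Basis. (v \<bullet> i) * frechet_derivative (\<phi> i) (at y) w)) (at y)"
      by (intro has_derivative_sum has_derivative_mult_right C1_on_has_derivative[OF C1 y])
    then have "((\<lambda>z. form1_in A c \<alpha> z v) has_derivative
       (\<lambda>w. \<Sum>i\<in>Basis. (v \<bullet> i) * frechet_derivative (\<phi> i) (at y) w)) (at y)"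
      by (rule has_derivative_transform_within_open[OF _ open_cimage[OF c(1)] y])
         (use form1_in_expand[OF assms(1) c(1)] in \<open>auto simp: \<phi>_def\<close>)
    from fun_cong[OF frechet_derivative_at[OF this]] show ?thesis by (rule sym)
  qed
  have p: "push f x v = D v x" for v
    by (simp add: push_def D_def c_def)
  show ?thesis
    unfolding d ext_deriv1_def Let_def c_def[symmetric] y_def[symmetric] e p
    by (simp add: sum.distrib symm)
qed

text \<open>In a chart each component is the contraction of the coordinates of
  \<open>\<Lambda>\<close> with those of \<open>\<omega>\<close>, a finite sum of products of smooth
  functions.\<close>

lemma liouville_C1_form:
  assumes "exact_symplectic A \<omega> \<Lambda>"
  shows "C1_form (liouville_form \<omega> \<Lambda>)"
  unfolding C1_form_def
proof (intro conjI allI ballI)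
  have bil: "bilinear (\<omega> p)" for p
    using assms by (simp add: exact_symplectic_def symplectic_form_def)
  then show "linear (liouville_form \<omega> \<Lambda> p)" for p
    by (auto simp: liouville_form_def[abs_def] bilinear_def)
  fix c v assume c: "c \<in> A"
  let ?S = "cmap c ` cdom c"
  let ?L = "\<lambda>x. to_coord A c (cinv c x) (\<Lambda> (cinv c x))"
  have L: "smooth_on ?S ?L" and w: "smooth_on ?S (\<lambda>x. form2_in A c \<omega> x i v)" for i
    using assms c by (auto simp: exact_symplectic_def symplectic_form_def smooth_vector_field_def)
  have "Ck_on (Suc 0) ?S (\<lambda>x. \<Sum>i\<in>Basis. (?L x \<bullet> i) * form2_in A c \<omega> x i v)"
    by (intro C1_on_sum C1_on_mult C1_on_inner smooth_on_C1 L w)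
  then show "Ck_on (Suc 0) ?S (\<lambda>x. form1_in A c (liouville_form \<omega> \<Lambda>) x v)"
  proof (rule C1_on_cong[OF open_cimage[OF c]])
    fix x assume x: "x \<in> ?S"
    then have p: "cinv c x \<in> cdom c" using cinv_in[OF c] by blast
    have "linear ((\<lambda>u. \<omega> (cinv c x) u (from_coord A c (cinv c x) v)) \<circ> from_coord A c (cinv c x))"
      using bil[of "cinv c x"] by (intro linear_compose linear_from_coord c p) (simp add: bilinear_def)
    from linear_euclidean_expand[OF this, of "?L x"]
    show "(\<Sum>i\<in>Basis. (?L x \<bullet> i) * form2_in A c \<omega> x i v) = form1_in A c (liouville_form \<omega> \<Lambda>) x v"
      by (simp add: form1_in_def form2_in_def liouville_form_def from_coord_to_coord[OF c p])
  qed
qed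

end

section \<open>The cylindrical end\<close>

text \<open>Mean value theorem for a primitive. Applied to \<open>H\<close> along a loop of mean
  value zero, it yields a point on \<open>\<Sigma>\<close>.\<close>

lemma integral_eq_0_imp_zero:
  fixes f :: "real \<Rightarrow> real"
  assumes "continuous_on {a..b} f" "a < b" "integral {a..b} f = 0"
  shows "\<exists>x\<in>{a..b}. f x = 0"
proof -
  obtain g where g: "\<And>x. x \<in> {a..b} \<Longrightarrow> (g has_vector_derivative f x) (at x within {a..b})"
    using antiderivative_continuous[OF assms(1)] by blast
  have "(f has_integral g b - g a) {a..b}"
    by (rule fundamental_theorem_of_calculus) (use g assms(2) in auto)
  then have "g b - g a = 0" using assms(3) by (simp add: integral_unique)
  moreover have "\<exists>x\<in>{a<..<b}. g b - g a = (b - a) *\<^sub>R f x"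
    using mvt_simple[OF assms(2), of g "\<lambda>x h. h *\<^sub>R f x"] g
    by (auto simp: has_vector_derivative_def)
  ultimately obtain x where "x \<in> {a<..<b}" "(b - a) *\<^sub>R f x = 0" by auto
  with assms(2) show ?thesis by (intro bexI[of _ x]) auto
qed

lemma C1_on_exp_uminus:
  fixes h :: "'a::real_normed_vector \<Rightarrow> real"
  assumes "Ck_on (Suc 0) S h"
  shows "Ck_on (Suc 0) S (\<lambda>x. exp (- h x))"
proof -
  have "Ck_on (Suc 0) UNIV (\<lambda>y::real. exp (- y))"
    by (rule C1_onI[where f' = "\<lambda>y v. v * - exp (- y)"])
       (auto intro!: derivative_eq_intros continuous_intros)
  from C1_on_compose[OF assms this] show ?thesis by (simp add: comp_def)
qed

locale sft_completion = smooth_manifold A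
  for A :: "('m::{t2_space,second_countable_topology}, 'e::euclidean_space) chart set" +
  fixes W U :: "'m set"
    and \<omega> :: "'m \<Rightarrow> 'e \<Rightarrow> 'e \<Rightarrow> real"
    and \<Lambda> R :: "'m \<Rightarrow> 'e"
    and \<epsilon> r\<^sub>0 :: real
    and r H :: "'m \<Rightarrow> real"
    and \<pi> :: "'m \<Rightarrow> 'm"
    and J :: "'m \<Rightarrow> 'e \<Rightarrow> 'e"
  assumes domain: "liouville_domain A W \<omega> \<Lambda>"
    and coords: "completion_coords A W \<omega> \<Lambda> \<epsilon> U r \<pi>"
    and reeb: "reeb_field A W \<omega> \<Lambda> R"
    and R_invariant: "r_invariant_field A U r \<pi> R"
    and sft: "sft_like A \<omega> \<Lambda> U r \<pi> R J"
    and hamiltonian: "defining_hamiltonian A W \<omega> R H"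
    and r\<^sub>0_pos: "0 < r\<^sub>0"
    and H_cylindrical: "\<And>p. p \<in> U \<Longrightarrow> r p > - r\<^sub>0 \<Longrightarrow> H p = exp (r p) - 1"
begin

abbreviation lam :: "'m \<Rightarrow> 'e \<Rightarrow> real" where "lam \<equiv> liouville_form \<omega> \<Lambda>"
abbreviation dr :: "'m \<Rightarrow> 'e \<Rightarrow> real" where "dr \<equiv> diff_fun A r"

lemma exact: "exact_symplectic A \<omega> \<Lambda>"
  using domain by (simp add: liouville_domain_def)

lemma bilinear_omega: "bilinear (\<omega> p)"
  using exact by (simp add: exact_symplectic_def symplectic_form_def)

lemma omega_self: "\<omega> p v v = 0"
  using exact by (simp add: exact_symplectic_def symplectic_form_def)

lemmas omega_simps =
  bilinear_ladd[OF bilinear_omega] bilinear_radd[OF bilinear_omega]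
  bilinear_lsub[OF bilinear_omega] bilinear_rsub[OF bilinear_omega]
  bilinear_lneg[OF bilinear_omega] bilinear_rneg[OF bilinear_omega]
  bilinear_lmul[OF bilinear_omega] bilinear_rmul[OF bilinear_omega]

lemma omega_antisym: "\<omega> p v w = - \<omega> p w v"
  using omega_self[of p "v + w", unfolded omega_simps] by (simp add: omega_self)

lemma omega_nondegenerate: "(\<And>w. \<omega> p v w = 0) \<Longrightarrow> v = 0"
  using exact unfolding exact_symplectic_def symplectic_form_def by blast

lemma
  shows open_U: "open U" and smooth_r: "smooth_fun A U r"
    and frontier_eq: "frontier W = {p \<in> U. r p = 0}"
    and outside_eq: "- W = {p \<in> U. r p > 0}"
proof -
  note * = coords[unfolded completion_coords_def]
  show "open U" "smooth_fun A U r" using * by blast+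
  have 1: "{p \<in> U. r p = 0} = frontier W" and 2: "{p \<in> U. r p > 0} = - W" using * by blast+
  from 1 show "frontier W = {p \<in> U. r p = 0}" by (rule sym)
  from 2 show "- W = {p \<in> U. r p > 0}" by (rule sym)
qed

lemma outside_iff: "p \<notin> W \<longleftrightarrow> p \<in> U \<and> r p > 0"
  using outside_eq by blast

lemma dr_Liouville:
  assumes "p \<in> U" shows "dr p (\<Lambda> p) = 1"
proof -
  have "\<forall>p\<in>U. dr p (\<Lambda> p) = 1 \<and> diff_map A \<pi> p (\<Lambda> p) = 0"
    using coords unfolding completion_coords_def by (elim conjE) assumption
  with assms show ?thesis by simp
qed

lemma lam_eq:
  assumes "p \<in> U" shows "lam p v = exp (r p) * lam (\<pi> p) (diff_map A \<pi> p v)"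
proof -
  have "\<forall>p\<in>U. \<forall>v. lam p v = exp (r p) * lam (\<pi> p) (diff_map A \<pi> p v)"
    using coords unfolding completion_coords_def by (elim conjE) assumption
  from this[rule_format, OF assms] show ?thesis .
qed

lemma collar_homeomorphism:
  obtains g where "homeomorphism U ({-\<epsilon><..} \<times> frontier W) (\<lambda>p. (r p, \<pi> p)) g"
proof -
  have "\<exists>g. homeomorphism U ({-\<epsilon><..} \<times> frontier W) (\<lambda>p. (r p, \<pi> p)) g"
    using coords unfolding completion_coords_def by (elim conjE) assumption
  with that show ?thesis by blast
qed

lemma proj_frontier:
  assumes "p \<in> U" shows "\<pi> p \<in> frontier W"
proof -
  obtain g where "homeomorphism U ({-\<epsilon><..} \<times> frontier W) (\<lambda>p. (r p, \<pi> p)) g"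
    by (rule collar_homeomorphism)
  then have "(r p, \<pi> p) \<in> {-\<epsilon><..} \<times> frontier W"
    using assms by (auto simp: homeomorphism_def)
  then show ?thesis by simp
qed

lemma
  shows linear_J: "linear (J p)" and J_J: "J p (J p v) = - v"
    and J_omega: "\<omega> p (J p v) (J p w) = \<omega> p v w"
    and J_positive: "v \<noteq> 0 \<Longrightarrow> \<omega> p v (J p v) > 0"
    and J_Liouville: "p \<in> U \<Longrightarrow> J p (\<Lambda> p) = R p"
    and J_contact: "p \<in> U \<Longrightarrow> v \<in> contact_plane A \<omega> \<Lambda> r \<pi> p \<Longrightarrow> J p v \<in> contact_plane A \<omega> \<Lambda> r \<pi> p"
proof -
  have ac: "almost_complex A J" and comp: "compatible_at \<omega> J p UNIV"
    and JL: "\<And>p. p \<in> U \<Longrightarrow> J p (\<Lambda> p) = R p"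
    and contact: "\<And>p. p \<in> U \<Longrightarrow> compatible_at \<omega> J p (contact_plane A \<omega> \<Lambda> r \<pi> p)" for p
    using sft by (simp_all add: sft_like_def)
  show "linear (J p)" "J p (J p v) = - v" using ac by (simp_all add: almost_complex_def)
  show "\<omega> p (J p v) (J p w) = \<omega> p v w" "v \<noteq> 0 \<Longrightarrow> \<omega> p v (J p v) > 0"
    using comp[of p] by (simp_all add: compatible_at_def metric_def)
  show "p \<in> U \<Longrightarrow> J p (\<Lambda> p) = R p" by (rule JL)
  show "p \<in> U \<Longrightarrow> v \<in> contact_plane A \<omega> \<Lambda> r \<pi> p \<Longrightarrow> J p v \<in> contact_plane A \<omega> \<Lambda> r \<pi> p"
    using contact[of p] by (simp add: compatible_at_def)
qed

lemma dr_linear: "p \<in> U \<Longrightarrow> linear (dr p)"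
  by (rule linear_diff_fun[OF smooth_r])

lemma lam_Liouville: "lam p (\<Lambda> p) = 0"
  by (simp add: liouville_form_def omega_self)

lemma lam_linear: "linear (lam p)"
  using bilinear_omega[of p] by (auto simp: liouville_form_def[abs_def] bilinear_def)

lemma
  assumes "p \<in> U"
  shows dr_R: "dr p (R p) = 0" and lam_R: "lam p (R p) = exp (r p)"
  using R_invariant reeb proj_frontier[OF assms] lam_eq[OF assms, of "R p"] assms
  by (auto simp: r_invariant_field_def reeb_field_def)

text \<open>By the splitting of the tangent space into \<open>\<real>\<Lambda>\<close>, \<open>\<real>R\<close> and \<open>\<xi>\<close>, this follows from the
  \<open>J\<close>-invariance of \<open>\<xi>\<close>, without computing \<open>d(e\<^sup>r \<lambda>|\<^sub>\<Sigma>)\<close>.\<close>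

lemma omega_R:
  assumes p: "p \<in> U"
  shows "\<omega> p v (R p) = exp (r p) * dr p v"
proof -
  define a where "a = dr p v"
  define b where "b = exp (- r p) * lam p v"
  define x where "x = v - a *\<^sub>R \<Lambda> p - b *\<^sub>R R p"
  have "dr p x = 0"
    using dr_Liouville[OF p] dr_R[OF p] linear_diff[OF dr_linear[OF p]] linear_cmul[OF dr_linear[OF p]]
    by (simp add: x_def a_def)
  moreover have "lam p x = 0"
    using lam_R[OF p] lam_Liouville[of p] linear_diff[OF lam_linear] linear_cmul[OF lam_linear]
    by (simp add: x_def b_def exp_minus)
  ultimately have "x \<in> contact_plane A \<omega> \<Lambda> r \<pi> p"
    using lam_eq[OF p, of x] by (simp add: contact_plane_def)
  from J_contact[OF p this] have "lam p (J p x) = 0"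
    using lam_eq[OF p] by (simp add: contact_plane_def)
  \<comment> \<open>As \<open>R = J \<Lambda>\<close>, the \<open>J\<close>-invariance of
    \<open>\<omega>\<close> moves \<open>J\<close> onto the component \<open>x\<close> in
    \<open>\<xi>\<close>.\<close>
  moreover have "\<omega> p x (R p) = lam p (J p x)"
    using J_omega[of p x "\<Lambda> p"] J_omega[of p x "R p"] J_J[of p "\<Lambda> p"] J_Liouville[OF p]
      omega_antisym[of p "J p x" "\<Lambda> p"]
    by (simp add: liouville_form_def omega_simps)
  moreover have "\<omega> p v (R p) = \<omega> p (a *\<^sub>R \<Lambda> p + b *\<^sub>R R p + x) (R p)" by (simp add: x_def)
  moreover have "\<omega> p (\<Lambda> p) (R p) = exp (r p)" using lam_R[OF p] by (simp add: liouville_form_def)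
  ultimately have "\<omega> p v (R p) = a * exp (r p)"
    by (simp add: omega_simps omega_self)
  then show ?thesis by (simp add: a_def)
qed

text \<open>Put \<open>J p v\<close> into \<open>omega_R\<close>, write \<open>R\<close> as
  \<open>J \<Lambda>\<close> and cancel \<open>J\<close>.\<close>

lemma dr_J:
  assumes p: "p \<in> U"
  shows "dr p (J p v) = - exp (- r p) * lam p v"
proof -
  have "exp (r p) * dr p (J p v) = \<omega> p (J p v) (J p (\<Lambda> p))"
    using omega_R[OF p] J_Liouville[OF p] by simp
  also have "\<dots> = - lam p v"
    using omega_antisym[of p v "\<Lambda> p"] by (simp add: J_omega liouville_form_def)
  finally show ?thesis by (simp add: exp_minus field_simps)
qed

text \<open>The left-hand side is the metric pairing of \<open>\<Lambda> p\<close> with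
  \<open>v\<close>, so \<open>\<Lambda>\<close> is the gradient of \<open>exp r\<close>. By
  \<open>J\<close>-invariance the claim reduces to \<open>omega_R\<close>.\<close>

lemma lam_J:
  assumes p: "p \<in> U"
  shows "lam p (J p v) = exp (r p) * dr p v"
proof -
  have "lam p (J p v) = \<omega> p (J p (\<Lambda> p)) (J p (J p v))"
    by (simp add: J_omega liouville_form_def)
  also have "\<dots> = \<omega> p v (R p)"
    using omega_antisym[of p v "R p"] by (simp add: J_Liouville[OF p] J_J omega_simps)
  finally show ?thesis by (simp add: omega_R[OF p])
qed

text \<open>Bessel's inequality: \<open>\<Lambda>\<close> and \<open>R\<close> are orthogonal of
  squared length \<open>exp r\<close>, the coefficients of \<open>w\<close> along them are
  \<open>a\<close> and \<open>b\<close>, and the remainder \<open>x\<close> has nonnegative squared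
  length.\<close>

lemma norm_ge_components:
  assumes p: "p \<in> U"
  shows "(dr p w)\<^sup>2 + (exp (- r p) * lam p w)\<^sup>2 \<le> exp (- r p) * \<omega> p w (J p w)"
proof -
  define a where "a = dr p w"
  define b where "b = exp (- r p) * lam p w"
  define x where "x = w - a *\<^sub>R \<Lambda> p - b *\<^sub>R R p"
  have JR: "J p (R p) = - \<Lambda> p" using J_J[of p "\<Lambda> p"] J_Liouville[OF p] by simp
  have Jx: "J p x = J p w - a *\<^sub>R R p + b *\<^sub>R \<Lambda> p"
    unfolding x_def by (simp add: linear_diff[OF linear_J] linear_cmul[OF linear_J] J_Liouville[OF p] JR)
  have lw: "lam p w = exp (r p) * b" by (simp add: b_def exp_minus)
  have eqs: "\<omega> p w (R p) = exp (r p) * a" "\<omega> p w (\<Lambda> p) = - exp (r p) * b"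
    "\<omega> p (\<Lambda> p) (J p w) = exp (r p) * a" "\<omega> p (\<Lambda> p) (R p) = exp (r p)"
    "\<omega> p (R p) (J p w) = exp (r p) * b" "\<omega> p (R p) (\<Lambda> p) = - exp (r p)"
    using omega_R[OF p, of w] omega_antisym[of p w "\<Lambda> p"] lam_J[OF p, of w] lam_R[OF p] lw
      omega_antisym[of p "R p" "J p w"] omega_R[OF p, of "J p w"] dr_J[OF p, of w]
      omega_antisym[of p "R p" "\<Lambda> p"]
    by (simp_all add: a_def liouville_form_def exp_minus)
  have "0 \<le> \<omega> p x (J p x)"
    using J_positive[of x p] by (cases "x = 0") (auto simp: omega_self bilinear_lzero[OF bilinear_omega])
  also have "\<omega> p x (J p x) = \<omega> p w (J p w) - exp (r p) * (a\<^sup>2 + b\<^sup>2)"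
    unfolding Jx unfolding x_def
    by (simp add: omega_simps eqs omega_self algebra_simps power2_eq_square)
  finally have "exp (r p) * (a\<^sup>2 + b\<^sup>2) \<le> \<omega> p w (J p w)" by simp
  then have "exp (- r p) * (exp (r p) * (a\<^sup>2 + b\<^sup>2)) \<le> exp (- r p) * \<omega> p w (J p w)"
    by (intro mult_left_mono) auto
  moreover have "exp (- r p) * (exp (r p) * (a\<^sup>2 + b\<^sup>2)) = a\<^sup>2 + b\<^sup>2"
    by (simp add: exp_minus)
  ultimately show ?thesis unfolding a_def[symmetric] b_def[symmetric] by linarith
qed

text \<open>An open set on which \<open>H\<close> is \<open>exp r - 1\<close>. It reaches across
  \<open>\<Sigma>\<close> into \<open>W\<close>, so that derivatives can also be computed at points
  of \<open>\<Sigma>\<close>.\<close>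

definition collar :: "'m set" where "collar = {p \<in> U. r p > - r\<^sub>0}"

lemma isCont_r: "p \<in> U \<Longrightarrow> isCont r p"
  by (rule smooth_fun_isCont[OF smooth_r open_U])

lemma open_collar: "open collar"
proof -
  have "continuous_on U r" by (intro continuous_at_imp_continuous_on ballI isCont_r)
  from continuous_open_preimage[OF this open_U open_greaterThan[of "- r\<^sub>0"]]
  show ?thesis by (simp add: collar_def vimage_def Int_def)
qed

lemma outside_subset_collar: "- W \<subseteq> collar"
  using outside_iff r\<^sub>0_pos by (auto simp: collar_def)

lemma frontier_subset_collar: "frontier W \<subseteq> collar"
  using frontier_eq r\<^sub>0_pos by (auto simp: collar_def)

lemma diff_fun_H:
  assumes "p \<in> collar"
  shows "diff_fun A H p v = exp (r p) * dr p v"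
proof -
  let ?c = "chart_at A p"
  have pU: "p \<in> U" using assms by (simp add: collar_def)
  have "((\<lambda>x. r (cinv ?c x)) has_derivative dr p) (at (cmap ?c p))"
    using diff_fun_has_derivative[OF smooth_r pU] unfolding comp_def .
  then have "((\<lambda>x. exp (r (cinv ?c x)) - 1) has_derivative
      (\<lambda>v. exp (r (cinv ?c (cmap ?c p))) * dr p v)) (at (cmap ?c p))"
    by (auto intro!: derivative_eq_intros)
  then have "((\<lambda>x. exp (r (cinv ?c x)) - 1) has_derivative (\<lambda>v. exp (r p) * dr p v)) (at (cmap ?c p))"
    by (simp add: cinv_cmap[OF chart_at_in in_chart_at])
  then have "(H \<circ> cinv ?c has_derivative (\<lambda>v. exp (r p) * dr p v)) (at (cmap ?c p))"
    by (rule has_derivative_transform_within_open[OF _ open_cimage_Int[OF chart_at_in open_collar]])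
       (use assms in_chart_at H_cylindrical in \<open>auto simp: cinv_cmap[OF chart_at_in] collar_def\<close>)
  from fun_cong[OF frechet_derivative_at[OF this]] show ?thesis
    unfolding diff_fun_def by (rule sym)
qed

text \<open>By \<open>lam_J\<close> the vector \<open>\<Lambda> p\<close> solves the defining
  equation. As \<open>J\<close> is onto and \<open>\<omega>\<close> nondegenerate, the solution is
  unique, which the definite description requires.\<close>

lemma grad_field_H:
  assumes "p \<in> collar"
  shows "grad_field A \<omega> J H p = \<Lambda> p"
  unfolding grad_field_def metric_def
proof (rule the_equality)
  have "p \<in> U" using assms by (simp add: collar_def)
  then show grad: "\<forall>v. diff_fun A H p v = \<omega> p (\<Lambda> p) (J p v)"
    using lam_J diff_fun_H[OF assms] by (simp add: liouville_form_def)
  fix Y assume Y: "\<forall>v. diff_fun A H p v = \<omega> p Y (J p v)"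
  have "\<omega> p (Y - \<Lambda> p) w = 0" for w
  proof -
    have "\<omega> p Y (J p (J p w)) = \<omega> p (\<Lambda> p) (J p (J p w))" using Y grad by metis
    then show ?thesis by (simp add: J_J omega_simps)
  qed
  then show "Y = \<Lambda> p" using omega_nondegenerate[of p "Y - \<Lambda> p"] by simp
qed

text \<open>\<open>r\<close> has a meaning only on \<open>U\<close>. The value \<open>0\<close> on
  all of \<open>W\<close> makes the function global and continuous.\<close>

definition height :: "'m \<Rightarrow> real" where "height p = (if p \<in> W then 0 else r p)"

lemma height_nonneg: "0 \<le> height p"
  using outside_iff[of p] by (auto simp: height_def)

lemma height_pos_iff: "0 < height p \<longleftrightarrow> p \<notin> W"
  using outside_iff[of p] by (auto simp: height_def)

lemma compact_W: "compact W" and closed_W: "closed W"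
  using domain compact_imp_closed by (auto simp: liouville_domain_def)

text \<open>On the collar it is the positive part of \<open>r\<close>; the rest lies in the interior
  of \<open>W\<close>, where it is locally zero.\<close>

lemma isCont_height: "isCont height p"
proof (cases "p \<in> collar")
  case True
  have "\<forall>\<^sub>F q in nhds p. height q = max 0 (r q)"
    unfolding eventually_nhds
  proof (intro exI[of _ collar] conjI open_collar True ballI)
    fix q assume "q \<in> collar"
    then show "height q = max 0 (r q)"
      using outside_iff[of q] by (auto simp: height_def collar_def)
  qed
  moreover have "isCont (\<lambda>q. max 0 (r q)) p"
    using True isCont_r by (intro continuous_intros) (auto simp: collar_def)
  ultimately show ?thesis by (simp add: isCont_cong)
next
  case False
  then have "p \<in> interior W"
    using frontier_subset_collar outside_subset_collar closed_W by (auto simp: frontier_def)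
  then have "\<forall>\<^sub>F q in nhds p. height q = 0"
    unfolding eventually_nhds using interior_subset[of W]
    by (intro exI[of _ "interior W"]) (auto simp: height_def)
  then show ?thesis by (simp add: isCont_cong)
qed

lemma isCont_H: "isCont H p"
  using hamiltonian by (intro smooth_fun_isCont[where N = UNIV]) (auto simp: defining_hamiltonian_def)

text \<open>The strip estimate for \<open>height\<close> along \<open>u\<close>, with the multiplier
  \<open>\<chi>\<close> as \<open>\<eta>\<close>. The resulting bound contains only \<open>C\<close>
  and \<open>m\<close>, whence its uniformity in \<open>u\<close>.\<close>

lemma flow_line_height_bound:
  assumes u: "u \<in> flow_lines A \<omega> J H x\<^sub>m x\<^sub>p"
    and C: "\<And>s. \<bar>chi A \<omega> J H (u s)\<bar> \<le> C"
    and m: "0 \<le> m" "\<And>p. p \<in> W \<Longrightarrow> - m \<le> H p"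
  shows "height (u s t) \<le> 2 * C + 3 + 32 * m"
proof -
  define f where "f x = u (fst x) (snd x)" for x :: "real \<times> real"
  define \<eta> where "\<eta> s = chi A \<omega> J H (u s)" for s
  have "smooth_into A UNIV (\<lambda>(s, t). u s t)" using u by (simp add: flow_lines_def)
  then have f: "smooth_into A UNIV f" by (simp add: f_def[abs_def] case_prod_beta')
  then have f_cont: "continuous_on UNIV f" by (simp add: smooth_into_def)
  have mean0: "mean H (u s) = 0" and periodic: "u s (t + 1) = u s t" for s t
    using u by (auto simp: flow_lines_def zero_mean_loops_def loops_def)
  define v where "v x = push f x (1, 0)" for x
  define w where "w x = push f x (0, 1)" for x
  have v: "velocity A (\<lambda>\<sigma>. u \<sigma> t) s = v (s, t)" for s t
  proof -
    have "((\<lambda>\<sigma>. (\<sigma>, t)) has_vector_derivative (1, 0)) (at s)"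
      by (auto intro!: derivative_eq_intros)
    from velocity_eq_push[OF f _ this] show ?thesis by (simp add: f_def v_def)
  qed
  have w: "velocity A (u s) t = w (s, t)" for s t
  proof -
    have "((\<lambda>\<tau>. (s, \<tau>)) has_vector_derivative (0, 1)) (at t)"
      by (auto intro!: derivative_eq_intros)
    from velocity_eq_push[OF f _ this] show ?thesis by (simp add: f_def w_def)
  qed
  have flow: "v (s, t) = - (J (u s t) (w (s, t)) + \<eta> s *\<^sub>R \<Lambda> (u s t))" if "u s t \<in> collar" for s t
    using u that v[of t s] w[of s t] grad_field_H[OF that]
    by (simp add: flow_lines_def grad_action_def \<eta>_def)
  define Q where "Q = {x. f x \<in> collar}"
  have "open Q" unfolding Q_def using open_chart_preimage[OF f open_UNIV open_collar] by simp
  have QU: "f x \<in> U" if "x \<in> Q" for x using that by (simp add: Q_def collar_def)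
  define h where "h x = r (f x)" for x
  have h_C1: "Ck_on (Suc 0) Q h"
    unfolding h_def[abs_def]
    by (rule Ck_on_subset[OF C1_on_fun_compose[OF smooth_r open_U f open_UNIV]]) (use QU in auto)
  have h_deriv: "(h has_derivative (\<lambda>d. dr (f x) (push f x d))) (at x)" if "x \<in> Q" for x
    unfolding h_def[abs_def] by (rule fun_push_has_derivative[OF smooth_r open_U f open_UNIV UNIV_I QU[OF that]])
  define lv where "lv x = lam (f x) (v x)" for x
  define lw where "lw x = lam (f x) (w x)" for x
  note lam_C1 = liouville_C1_form[OF exact]
  have lv_C1: "Ck_on (Suc 0) Q lv" and lw_C1: "Ck_on (Suc 0) Q lw"
    unfolding lv_def[abs_def] lw_def[abs_def] v_def w_def
    by (rule Ck_on_subset[OF C1_on_form_push[OF lam_C1 f open_UNIV] subset_UNIV])+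
  \<comment> \<open>On \<open>Q\<close> the flow equation makes \<open>a\<close> equal to
    \<open>\<partial>\<^sub>s h + \<eta>\<close> and \<open>b\<close> equal to
    \<open>- \<partial>\<^sub>t h\<close>. Differentiating \<open>a\<close> as a whole avoids
    differentiating \<open>\<eta>\<close>.\<close>
  define a where "a x = exp (- h x) * lw x" for x
  define b where "b x = exp (- h x) * lv x" for x
  have a_C1: "Ck_on (Suc 0) Q a" and b_C1: "Ck_on (Suc 0) Q b"
    unfolding a_def[abs_def] b_def[abs_def] by (intro C1_on_mult C1_on_exp_uminus h_C1 lv_C1 lw_C1)+
  have dr_v: "dr (f x) (v x) = a x - \<eta> (fst x)"
    and dr_w: "dr (f x) (w x) = - b x"
    and omega_vw: "\<omega> (f x) (v x) (w x) = \<omega> (f x) (w x) (J (f x) (w x)) - \<eta> (fst x) * lw x"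
    if x: "x \<in> Q" for x
  proof -
    have v_eq: "v x = - (J (f x) (w x)) - \<eta> (fst x) *\<^sub>R \<Lambda> (f x)"
      using flow[of "fst x" "snd x"] x by (simp add: Q_def f_def)
    note lin = linear_diff[OF dr_linear[OF QU[OF x]]] linear_cmul[OF dr_linear[OF QU[OF x]]]
      linear_neg[OF dr_linear[OF QU[OF x]]]
      linear_diff[OF lam_linear] linear_cmul[OF lam_linear] linear_neg[OF lam_linear]
    show "dr (f x) (v x) = a x - \<eta> (fst x)"
      unfolding v_eq by (simp add: lin dr_J dr_Liouville QU[OF x] a_def lw_def h_def)
    have "lv x = - exp (h x) * dr (f x) (w x)"
      unfolding lv_def v_eq by (simp add: lin lam_J lam_Liouville QU[OF x] h_def)
    then show "dr (f x) (w x) = - b x" by (simp add: b_def exp_minus)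
    show "\<omega> (f x) (v x) (w x) = \<omega> (f x) (w x) (J (f x) (w x)) - \<eta> (fst x) * lw x"
      unfolding v_eq using omega_antisym[of "f x" "J (f x) (w x)" "w x"]
      by (simp add: omega_simps lw_def liouville_form_def)
  qed
  define a' where "a' x = frechet_derivative a (at x) (1, 0)" for x
  define b' where "b' x = frechet_derivative b (at x) (0, 1)" for x
  \<comment> \<open>Since the exterior derivative of the Liouville form is \<open>\<omega>\<close>,
    the derivatives of \<open>lw\<close> and \<open>lv\<close> combine to \<open>\<omega>\<close> of
    \<open>v\<close> and \<open>w\<close>. The flow equation turns this into the squared length of
    \<open>w\<close> minus \<open>\<eta> * lw\<close>, whose \<open>\<eta>\<close>-part cancels the
    one from differentiating \<open>exp (- h)\<close>; Bessel's inequality does the rest.\<close>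
  have laplace: "0 \<le> a' x - b' x" if x: "x \<in> Q" for x
  proof -
    have d: "((\<lambda>x. exp (- h x) * l x) has_derivative (\<lambda>d. exp (- h x) * frechet_derivative l (at x) d +
        (- exp (- h x) * dr (f x) (push f x d)) * l x)) (at x)" if "Ck_on (Suc 0) Q l" for l
      using h_deriv[OF x] C1_on_has_derivative[OF that x] by (auto intro!: derivative_eq_intros)
    have "a' x = exp (- h x) * frechet_derivative lw (at x) (1, 0) - (a x - \<eta> (fst x)) * a x"
      using fun_cong[OF frechet_derivative_at[OF d[OF lw_C1]], of "(1, 0)"] dr_v[OF x]
      by (simp add: a'_def a_def[abs_def] v_def mult_ac)
    moreover have "b' x = exp (- h x) * frechet_derivative lv (at x) (0, 1) + b x * b x"
      using fun_cong[OF frechet_derivative_at[OF d[OF lv_C1]], of "(0, 1)"] dr_w[OF x]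
      by (simp add: b'_def b_def[abs_def] w_def mult_ac)
    moreover have "frechet_derivative lw (at x) (1, 0) - frechet_derivative lv (at x) (0, 1) = \<omega> (f x) (v x) (w x)"
      using ext_deriv1_push[OF lam_C1 f open_UNIV UNIV_I, of x] exact
      by (simp add: lw_def[abs_def] lv_def[abs_def] v_def w_def exact_symplectic_def)
    ultimately have "a' x - b' x = exp (- h x) * \<omega> (f x) (v x) (w x) - (a x - \<eta> (fst x)) * a x - (b x)\<^sup>2"
      by (simp add: algebra_simps power2_eq_square)
    also have "\<dots> = exp (- h x) * \<omega> (f x) (w x) (J (f x) (w x)) - (a x)\<^sup>2 - (b x)\<^sup>2"
      unfolding omega_vw[OF x] by (simp add: a_def algebra_simps power2_eq_square)
    also have "\<dots> \<ge> 0"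
      using norm_ge_components[OF QU[OF x], of "w x"] dr_w[OF x] by (simp add: a_def lw_def h_def)
    finally show ?thesis .
  qed
  have H_cont: "continuous_on S (\<lambda>t. H (u s t))" for s S
  proof -
    have "continuous_on S (\<lambda>t. f (s, t))"
      by (rule continuous_on_compose2[OF f_cont]) (auto intro!: continuous_intros)
    then have "continuous_on S (\<lambda>t. H (f (s, t)))"
      by (rule continuous_on_compose2[of UNIV H, rotated])
         (auto intro!: continuous_at_imp_continuous_on isCont_H)
    then show ?thesis by (simp add: f_def)
  qed
  have hits: "\<exists>t\<in>{0..1}. u s t \<in> frontier W" for s
  proof -
    have "\<exists>t\<in>{0..1}. H (u s t) = 0"
      using mean0[of s] by (intro integral_eq_0_imp_zero H_cont) (auto simp: mean_def)
    then show ?thesis using hamiltonian by (auto simp: defining_hamiltonian_def)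
  qed
  \<comment> \<open>Instead of the quotient of integrals defining \<open>\<chi>\<close>, use
    \<open>\<eta> = a - \<partial>\<^sub>s h\<close> on the horizontal line through a point that
    \<open>u\<close> maps to \<open>\<Sigma>\<close>; near that point the line stays in
    \<open>Q\<close>.\<close>
  have \<eta>_cont: "continuous_on UNIV \<eta>"
  proof (intro continuous_at_imp_continuous_on ballI)
    fix s
    obtain t where t: "u s t \<in> frontier W" using hits[of s] by blast
    let ?N = "(\<lambda>\<sigma>. (\<sigma>, t)) -` Q"
    have N: "open ?N" by (intro open_vimage \<open>open Q\<close> continuous_intros)
    have s: "s \<in> ?N" using t frontier_subset_collar by (auto simp: Q_def f_def)
    let ?e = "\<lambda>x. a x - frechet_derivative h (at x) (1, 0)"
    have "continuous_on Q ?e"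
      by (intro continuous_on_diff C1_on_imp_continuous_on[OF a_C1] C1_on_continuous_derivative[OF h_C1])
    then have e: "isCont ?e (s, t)" using \<open>open Q\<close> s by (simp add: continuous_on_eq_continuous_at)
    have "isCont (\<lambda>\<sigma>. (\<sigma>, t)) s" by (intro continuous_intros)
    from isCont_o2[OF this e] have "isCont (\<lambda>\<sigma>. ?e (\<sigma>, t)) s" .
    moreover have "\<forall>\<^sub>F \<sigma> in nhds s. ?e (\<sigma>, t) = \<eta> \<sigma>"
      unfolding eventually_nhds
    proof (intro exI[of _ ?N] conjI N s ballI)
      fix \<sigma> assume "\<sigma> \<in> ?N"
      then have x: "(\<sigma>, t) \<in> Q" by simp
      have "frechet_derivative h (at (\<sigma>, t)) (1, 0) = dr (f (\<sigma>, t)) (v (\<sigma>, t))"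
        using fun_cong[OF frechet_derivative_at[OF h_deriv[OF x]], of "(1, 0)"] by (simp add: v_def)
      then show "?e (\<sigma>, t) = \<eta> \<sigma>" using dr_v[OF x] by simp
    qed
    ultimately show "isCont \<eta> s" by (simp add: isCont_cong)
  qed
  define k where "k s t = height (u s t)" for s t
  have k_cont: "continuous_on UNIV (\<lambda>x. k (fst x) (snd x))"
    unfolding k_def f_def[symmetric]
    by (rule continuous_on_compose2[OF _ f_cont])
       (auto intro!: continuous_at_imp_continuous_on isCont_height)
  have k_pos: "(s, t) \<in> Q" if "0 < k s t" for s t
    using that outside_subset_collar by (auto simp: k_def height_pos_iff Q_def f_def)
  have k_eq: "h x = k (fst x) (snd x)" if "0 < k (fst x) (snd x)" for x
    using that unfolding k_def height_pos_iff by (simp add: h_def f_def height_def)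
  have open_pos: "open {x. 0 < k (fst x) (snd x)}"
    by (rule open_Collect_less[OF continuous_on_const k_cont])
  have pos_Q: "{x. 0 < k (fst x) (snd x)} \<subseteq> Q" using k_pos by auto
  have "k s t \<le> 2 * C + 3 + 32 * m"
  proof (rule subharmonic_strip_bound[where k = k and \<eta> = \<eta> and a = "\<lambda>s t. a (s, t)" and b = "\<lambda>s t. b (s, t)"
        and a' = "\<lambda>s t. a' (s, t)" and b' = "\<lambda>s t. b' (s, t)"])
    show "continuous_on UNIV (\<lambda>x. k (fst x) (snd x))" by (rule k_cont)
    show "0 \<le> k s t" for s t by (simp add: k_def height_nonneg)
    show "k s (t + 1) = k s t" for s t by (simp add: k_def periodic)
    show "\<exists>t\<in>{0..1}. k s t = 0" for s
      using hits[of s] closed_W by (fastforce simp: k_def height_def frontier_def)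
    show "integral {0..1} (\<lambda>t. exp (k s t) - 1) \<le> m" for s
    proof -
      have "continuous_on {0..1} (\<lambda>t. k s t)"
        by (rule continuous_on_compose2[OF k_cont, where f="\<lambda>t. (s, t)", simplified])
           (auto intro!: continuous_intros)
      then have "integral {0..1} (\<lambda>t. exp (k s t) - 1) \<le> integral {0..1} (\<lambda>t. H (u s t) + m)"
      proof (intro integral_le integrable_continuous_interval continuous_intros H_cont)
        fix t
        \<comment> \<open>On \<open>W\<close> the left-hand side is \<open>0\<close> and
          \<open>- m\<close> bounds \<open>H\<close> from below; outside \<open>W\<close> it equals
          \<open>H\<close>. Integration then leaves \<open>m\<close>, as \<open>H\<close> has mean
          value zero along the loop.\<close>
        show "exp (k s t) - 1 \<le> H (u s t) + m"
        proof (cases "u s t \<in> W")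
          case False
          then have "u s t \<in> collar" using outside_subset_collar by blast
          then show ?thesis using H_cylindrical[of "u s t"] m(1) False
            by (simp add: collar_def k_def height_def)
        qed (use m(2)[of "u s t"] in \<open>simp add: k_def height_def\<close>)
      qed
      also have "\<dots> = m"
        using mean0[of s] by (subst integral_add) (auto intro!: integrable_continuous_interval H_cont simp: mean_def)
      finally show ?thesis .
    qed
    show "continuous_on UNIV \<eta>" by (rule \<eta>_cont)
    show "\<bar>\<eta> s\<bar> \<le> C" for s using C by (simp add: \<eta>_def)
  next
    fix s t assume pos: "0 < k s t"
    note Q = k_pos[OF pos]
    have "(h has_derivative (\<lambda>d. dr (f (s, t)) (push f (s, t) d))) (at (s, t))" by (rule h_deriv[OF Q])
    \<comment> \<open>\<open>k\<close> agrees with \<open>h\<close> on the open set where it is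
      positive and inherits its derivative there.\<close>
    then have k: "((\<lambda>x. k (fst x) (snd x)) has_derivative (\<lambda>d. dr (f (s, t)) (push f (s, t) d))) (at (s, t))"
      by (rule has_derivative_transform_within_open[OF _ open_pos]) (use pos k_eq in auto)
    show "((\<lambda>s. k s t) has_real_derivative a (s, t) - \<eta> s) (at s)"
      using has_derivative_partials(1)[OF k] dr_v[OF Q]
      by (simp add: has_real_derivative_iff_has_vector_derivative v_def)
    show "((\<lambda>t. k s t) has_real_derivative - b (s, t)) (at t)"
      using has_derivative_partials(2)[OF k] dr_w[OF Q]
      by (simp add: has_real_derivative_iff_has_vector_derivative w_def)
    show "((\<lambda>s. a (s, t)) has_real_derivative a' (s, t)) (at s)"
      using has_derivative_partials(1)[OF C1_on_has_derivative[OF a_C1 Q]]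
      by (simp add: has_real_derivative_iff_has_vector_derivative a'_def)
    show "((\<lambda>t. b (s, t)) has_real_derivative b' (s, t)) (at t)"
      using has_derivative_partials(2)[OF C1_on_has_derivative[OF b_C1 Q]]
      by (simp add: has_real_derivative_iff_has_vector_derivative b'_def)
    show "0 \<le> a' (s, t) - b' (s, t)" by (rule laplace[OF Q])
  qed (simp_all only: prod.collapse a'_def b'_def,
       (rule continuous_on_subset[OF _ pos_Q] C1_on_imp_continuous_on[OF a_C1] C1_on_imp_continuous_on[OF b_C1]
          C1_on_continuous_derivative[OF a_C1] C1_on_continuous_derivative[OF b_C1])+)
  then show ?thesis by (simp add: k_def)
qed

text \<open>The part described by \<open>r\<close> is the image of the compact set
  \<open>{0..B} \<times> frontier W\<close> under the inverse of the collar coordinates.\<close>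

lemma compact_sublevel: "compact (W \<union> {p \<in> U. 0 \<le> r p \<and> r p \<le> B})"
proof -
  have "\<epsilon> > 0" using coords by (simp add: completion_coords_def)
  obtain g where g: "homeomorphism U ({-\<epsilon><..} \<times> frontier W) (\<lambda>p. (r p, \<pi> p)) g"
    by (rule collar_homeomorphism)
  have sub: "{0..B} \<times> frontier W \<subseteq> {-\<epsilon><..} \<times> frontier W" using \<open>\<epsilon> > 0\<close> by auto
  have "compact (frontier W)"
    using compact_Int_closed[OF compact_W frontier_closed[of W]] closed_W
    by (simp add: frontier_subset_closed Int_absorb1)
  then have "compact (g ` ({0..B} \<times> frontier W))"
    using g sub by (intro compact_continuous_image compact_Times compact_Icc)
      (auto simp: homeomorphism_def intro: continuous_on_subset)
  moreover have "g ` ({0..B} \<times> frontier W) = {p \<in> U. 0 \<le> r p \<and> r p \<le> B}"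
  proof (intro subset_antisym subsetI)
    fix p assume "p \<in> g ` ({0..B} \<times> frontier W)"
    then obtain y where y: "y \<in> {0..B} \<times> frontier W" "p = g y" by blast
    with g sub have "p \<in> U" "(r p, \<pi> p) = y" by (auto simp: homeomorphism_def)
    with y show "p \<in> {p \<in> U. 0 \<le> r p \<and> r p \<le> B}" by auto
  next
    fix p assume p: "p \<in> {p \<in> U. 0 \<le> r p \<and> r p \<le> B}"
    then have "g (r p, \<pi> p) = p" using g by (simp add: homeomorphism_def)
    with p proj_frontier[of p] show "p \<in> g ` ({0..B} \<times> frontier W)"
      by (intro image_eqI[of _ _ "(r p, \<pi> p)"]) auto
  qed
  ultimately show ?thesis using compact_W by (simp add: compact_Un)
qed

end

theorem lemma2p8:
  fixes A :: "('m::{t2_space,second_countable_topology}, 'e::euclidean_space) chart set"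
    and W U :: "'m set"
    and \<omega> :: "'m \<Rightarrow> 'e \<Rightarrow> 'e \<Rightarrow> real"
    and \<Lambda> R :: "'m \<Rightarrow> 'e"
    and \<epsilon> r\<^sub>0 :: real
    and r H :: "'m \<Rightarrow> real"
    and \<pi> :: "'m \<Rightarrow> 'm"
    and J :: "'m \<Rightarrow> 'e \<Rightarrow> 'e"
    and x\<^sub>m x\<^sub>p :: "real \<Rightarrow> 'm"
  assumes "smooth_atlas A"
    and "liouville_domain A W \<omega> \<Lambda>"
    and "completion_coords A W \<omega> \<Lambda> \<epsilon> U r \<pi>"
    and "reeb_field A W \<omega> \<Lambda> R"
    and "r_invariant_field A U r \<pi> R"
    and "sft_like A \<omega> \<Lambda> U r \<pi> R J"
    and "defining_hamiltonian A W \<omega> R H"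
    and "0 < r\<^sub>0" and "r\<^sub>0 < \<epsilon>"
    and "\<And>p. p \<in> U \<Longrightarrow> r p > - r\<^sub>0 \<Longrightarrow> H p = exp (r p) - 1"
    and "morse_bott A \<omega> \<Lambda> H"
    and "x\<^sub>m \<in> crit A \<omega> H" and "x\<^sub>p \<in> crit A \<omega> H"
    and "\<exists>C. \<forall>u\<in>flow_lines A \<omega> J H x\<^sub>m x\<^sub>p. \<forall>s. \<bar>chi A \<omega> J H (u s)\<bar> \<le> C"
  shows "\<exists>K. compact K \<and> (\<forall>u\<in>flow_lines A \<omega> J H x\<^sub>m x\<^sub>p. \<forall>s t. u s t \<in> K)"
proof -
  interpret sft_completion A W U \<omega> \<Lambda> R \<epsilon> r\<^sub>0 r H \<pi> J
    by unfold_locales (use assms in auto)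
  obtain C where C: "\<forall>u\<in>flow_lines A \<omega> J H x\<^sub>m x\<^sub>p. \<forall>s. \<bar>chi A \<omega> J H (u s)\<bar> \<le> C"
    using assms(14) by blast
  have "compact (H ` W)"
    by (intro compact_continuous_image continuous_at_imp_continuous_on ballI isCont_H compact_W)
  from compact_imp_bounded[OF this] obtain m where "\<forall>y\<in>H ` W. norm y \<le> m"
    unfolding bounded_iff by blast
  then have m: "\<bar>H p\<bar> \<le> m" if "p \<in> W" for p
    using that by auto
  \<comment> \<open>\<open>max 0 m\<close> because the bound \<open>m\<close> can be negative when
    \<open>W\<close> is empty.\<close>
  define B where "B = 2 * C + 3 + 32 * max 0 m"
  have "u s t \<in> W \<union> {p \<in> U. 0 \<le> r p \<and> r p \<le> B}" if u: "u \<in> flow_lines A \<omega> J H x\<^sub>m x\<^sub>p" for u s t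
  proof (cases "u s t \<in> W")
    case False
    have "height (u s t) \<le> B"
      unfolding B_def
    proof (rule flow_line_height_bound[OF u])
      show "- max 0 m \<le> H p" if "p \<in> W" for p using m[OF that] by linarith
    qed (use C u in auto)
    with False outside_iff[of "u s t"] show ?thesis by (simp add: height_def)
  qed simp
  then show ?thesis using compact_sublevel[of B] by blast
qed

end
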